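(* Let $M$ be an Artin-Tits monoid. Then $M$ satisfies the $3$-Ore condition if and only if $M$ is of type FC.
   Context: An Artin-Tits monoid is a monoid given by a presentation $\langle S\mid R\rangle^+$ with $S$ finite, where $R$ contains at most one relation of the form $s\cdots = t\cdots$ for each pair of distinct generators $s,t\in S$ and, if there is one, it has the form $sts\cdots = tst\cdots$ (alternating words, both sides of the same length $\ge 2$). Every Artin-Tits monoid is cancellative, has no nontrivial invertible element, any two elements have a left and a right gcd, and it is noetherian. $M$ is of spherical type if the Coxeter group obtained by adding to $R$ the relations $s^2=1$ for all $s\in S$ is finite. For $I\subseteq S$, $M_I$ is the standard parabolic submonoid generated by $I$, which is the Artin-Tits monoid $\langle I\mid R_I\rangle^+$, where $R_I$ consists of those relations of $R$ that only involve generators from $I$. $M$ is of type FC if, for every $I\subseteq S$ such that any two elements of $I$ admit a common multiple in $M$ (that is, $R$ contains a relation for every pair of distinct elements of $I$), the monoid $M_I$ is of spherical type. $3$-Ore condition: any three elements of $M$ that pairwise admit a common right multiple admit a global common right multiple, and any three elements of $M$ that pairwise admit a common left multiple admit a global common left multiple. Here $b$ is a right (resp. left) multiple of $a$ if $b=ax$ (resp. $b=xa$) for some $x\in M$. *)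

theory Defs
  imports "HOL-Algebra.Group"
begin

section \<open>Monoids given by presentations\<close>

inductive_set pres_cong :: "'a set \<Rightarrow> ('a list \<times> 'a list) set \<Rightarrow> ('a list \<times> 'a list) set"
  for S :: "'a set" and R :: "('a list \<times> 'a list) set"
where
  refl: "w \<in> lists S \<Longrightarrow> (w, w) \<in> pres_cong S R"
| rel: "(u, v) \<in> R \<Longrightarrow> u \<in> lists S \<Longrightarrow> v \<in> lists S \<Longrightarrow> x \<in> lists S \<Longrightarrow> y \<in> lists S
    \<Longrightarrow> (x @ u @ y, x @ v @ y) \<in> pres_cong S R"
| sym: "(u, v) \<in> pres_cong S R \<Longrightarrow> (v, u) \<in> pres_cong S R"
| trans: "(u, v) \<in> pres_cong S R \<Longrightarrow> (v, w) \<in> pres_cong S R \<Longrightarrow> (u, w) \<in> pres_cong S R"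

definition pres_class :: "'a set \<Rightarrow> ('a list \<times> 'a list) set \<Rightarrow> 'a list \<Rightarrow> 'a list set" where
  "pres_class S R w = pres_cong S R `` {w}"

definition presented_monoid :: "'a set \<Rightarrow> ('a list \<times> 'a list) set \<Rightarrow> 'a list set monoid" where
  "presented_monoid S R =
     \<lparr>carrier = lists S // pres_cong S R,
      mult = (\<lambda>A B. \<Union>u\<in>A. \<Union>v\<in>B. pres_class S R (u @ v)),
      one = pres_class S R []\<rparr>"

lemma pres_cong_lists: "(u, v) \<in> pres_cong S R \<Longrightarrow> u \<in> lists S \<and> v \<in> lists S"
  by (induction rule: pres_cong.induct) auto

lemma equiv_pres_cong: "equiv (lists S) (pres_cong S R)"
proof (rule equivI)
  show "pres_cong S R \<subseteq> lists S \<times> lists S"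
    using pres_cong_lists by fastforce
  show "refl_on (lists S) (pres_cong S R)"
    by (rule refl_onI) (rule pres_cong.refl)
  show "Relation.sym (pres_cong S R)"
    by (rule symI) (rule pres_cong.sym)
  show "Relation.trans (pres_cong S R)"
    by (rule transI) (rule pres_cong.trans)
qed

lemma pres_cong_context:
  "(u, v) \<in> pres_cong S R \<Longrightarrow> x \<in> lists S \<Longrightarrow> y \<in> lists S
     \<Longrightarrow> (x @ u @ y, x @ v @ y) \<in> pres_cong S R"
proof (induction rule: pres_cong.induct)
  case (refl w)
  then show ?case by (intro pres_cong.refl) auto
next
  case (rel u v x' y')
  then show ?case
    using pres_cong.rel[of u v R S "x @ x'" "y' @ y"] by simp
next
  case (sym u v)
  then show ?case by (simp add: pres_cong.sym)
next
  case (trans u v w)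
  then show ?case using pres_cong.trans by metis
qed

lemma pres_cong_append:
  assumes "(u, u') \<in> pres_cong S R" "(v, v') \<in> pres_cong S R"
  shows "(u @ v, u' @ v') \<in> pres_cong S R"
proof -
  have "(u @ v, u' @ v) \<in> pres_cong S R"
    using pres_cong_context[OF assms(1), of "[]" v] pres_cong_lists[OF assms(2)] by simp
  moreover have "(u' @ v, u' @ v') \<in> pres_cong S R"
    using pres_cong_context[OF assms(2), of u' "[]"] pres_cong_lists[OF assms(1)] by simp
  ultimately show ?thesis by (rule pres_cong.trans)
qed

lemma pres_class_eq_iff:
  "u \<in> lists S \<Longrightarrow> v \<in> lists S \<Longrightarrow>
     pres_class S R u = pres_class S R v \<longleftrightarrow> (u, v) \<in> pres_cong S R"
  unfolding pres_class_def by (rule eq_equiv_class_iff[OF equiv_pres_cong])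

lemma carrier_presented_monoid: "carrier (presented_monoid S R) = pres_class S R ` lists S"
  by (auto simp: presented_monoid_def pres_class_def quotient_def)

lemma one_presented_monoid: "\<one>\<^bsub>presented_monoid S R\<^esub> = pres_class S R []"
  by (simp add: presented_monoid_def)

lemma mult_presented_monoid:
  assumes "u \<in> lists S" "v \<in> lists S"
  shows "pres_class S R u \<otimes>\<^bsub>presented_monoid S R\<^esub> pres_class S R v = pres_class S R (u @ v)"
proof -
  have *: "pres_class S R (u' @ v') = pres_class S R (u @ v)"
    if "u' \<in> pres_class S R u" "v' \<in> pres_class S R v" for u' v'
  proof -
    have "(u @ v, u' @ v') \<in> pres_cong S R"
      using that by (intro pres_cong_append) (auto simp: pres_class_def)
    then show ?thesis
      unfolding pres_class_def by (rule equiv_class_eq[OF equiv_pres_cong, symmetric])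
  qed
  have "u \<in> pres_class S R u" "v \<in> pres_class S R v"
    using assms by (auto simp: pres_class_def intro: pres_cong.refl)
  with * have "(\<Union>u'\<in>pres_class S R u. \<Union>v'\<in>pres_class S R v. pres_class S R (u' @ v')) =
      pres_class S R (u @ v)"
    by blast
  then show ?thesis
    by (simp add: presented_monoid_def)
qed

lemma monoid_presented_monoid: "monoid (presented_monoid S R)"
  by (rule monoidI)
     (auto simp: carrier_presented_monoid one_presented_monoid mult_presented_monoid
        in_lists_conv_set ball_Un intro!: imageI)

section \<open>Artin-Tits presentations, spherical type and type FC\<close>

primrec alt_word :: "'a \<Rightarrow> 'a \<Rightarrow> nat \<Rightarrow> 'a list" where
  "alt_word s t 0 = []"
| "alt_word s t (Suc n) = s # alt_word t s n"

definition braid_relation :: "'a \<Rightarrow> 'a \<Rightarrow> 'a list \<times> 'a list \<Rightarrow> bool" where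
  "braid_relation s t r \<longleftrightarrow> (\<exists>n\<ge>2. r = (alt_word s t n, alt_word t s n))"

text \<open>
  Relations are equations, so their orientation is immaterial: the uniqueness clause is about
  unordered pairs of generators.
\<close>

definition artin_tits_presentation :: "'a set \<Rightarrow> ('a list \<times> 'a list) set \<Rightarrow> bool" where
  "artin_tits_presentation S R \<longleftrightarrow>
     finite S \<and>
     (\<forall>r\<in>R. \<exists>s\<in>S. \<exists>t\<in>S. s \<noteq> t \<and> braid_relation s t r) \<and>
     (\<forall>s\<in>S. \<forall>t\<in>S. s \<noteq> t \<longrightarrow>
        (\<exists>\<^sub>\<le>\<^sub>1 r. r \<in> R \<and> (braid_relation s t r \<or> braid_relation t s r)))"

definition parabolic_relations :: "('a list \<times> 'a list) set \<Rightarrow> 'a set \<Rightarrow> ('a list \<times> 'a list) set" where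
  "parabolic_relations R I = R \<inter> (lists I \<times> lists I)"

text \<open>
  Since every generator becomes its own inverse, the monoid and the group presented by \<open>S\<close> and
  the relations \<open>R\<close> together with \<open>s\<^sup>2 = 1\<close> coincide; see \<open>group_coxeter_group\<close> below.
\<close>

definition coxeter_group :: "'a set \<Rightarrow> ('a list \<times> 'a list) set \<Rightarrow> 'a list set monoid" where
  "coxeter_group S R = presented_monoid S (R \<union> {([s, s], []) | s. s \<in> S})"

lemma group_coxeter_group: "group (coxeter_group S R)"
proof -
  let ?R = "R \<union> {([s, s], []) | s. s \<in> S}"
  interpret monoid "coxeter_group S R"
    unfolding coxeter_group_def by (rule monoid_presented_monoid)
  have inv: "(rev w @ w, []) \<in> pres_cong S ?R" if "w \<in> lists S" for w
    using that
  proof (induction w)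
    case Nil
    then show ?case by (simp add: pres_cong.refl)
  next
    case (Cons s w)
    have "(rev w @ [s, s] @ w, rev w @ [] @ w) \<in> pres_cong S ?R"
      using Cons.hyps by (intro pres_cong.rel) auto
    then show ?case
      using Cons.IH by (auto intro: pres_cong.trans)
  qed
  show ?thesis
  proof (rule group_l_invI)
    fix x assume "x \<in> carrier (coxeter_group S R)"
    then obtain w where w: "w \<in> lists S" "x = pres_class S ?R w"
      by (auto simp: coxeter_group_def carrier_presented_monoid)
    have rev: "rev w \<in> lists S"
      using w(1) by (simp add: in_lists_conv_set)
    have "pres_class S ?R (rev w) \<otimes>\<^bsub>coxeter_group S R\<^esub> x = \<one>\<^bsub>coxeter_group S R\<^esub>"
      using w rev inv[OF w(1)]
      by (simp add: coxeter_group_def mult_presented_monoid one_presented_monoid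
          pres_class_eq_iff)
    moreover have "pres_class S ?R (rev w) \<in> carrier (coxeter_group S R)"
      using rev by (simp add: coxeter_group_def carrier_presented_monoid)
    ultimately show "\<exists>y\<in>carrier (coxeter_group S R).
        y \<otimes>\<^bsub>coxeter_group S R\<^esub> x = \<one>\<^bsub>coxeter_group S R\<^esub>"
      by blast
  qed
qed

definition spherical_type :: "'a set \<Rightarrow> ('a list \<times> 'a list) set \<Rightarrow> bool" where
  "spherical_type S R \<longleftrightarrow> finite (carrier (coxeter_group S R))"

definition right_multiple :: "('b, 'c) monoid_scheme \<Rightarrow> 'b \<Rightarrow> 'b \<Rightarrow> bool" where
  "right_multiple G b a \<longleftrightarrow> (\<exists>x\<in>carrier G. b = a \<otimes>\<^bsub>G\<^esub> x)"

definition left_multiple :: "('b, 'c) monoid_scheme \<Rightarrow> 'b \<Rightarrow> 'b \<Rightarrow> bool" where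
  "left_multiple G b a \<longleftrightarrow> (\<exists>x\<in>carrier G. b = x \<otimes>\<^bsub>G\<^esub> a)"

definition have_common_right_multiple :: "('b, 'c) monoid_scheme \<Rightarrow> 'b set \<Rightarrow> bool" where
  "have_common_right_multiple G A \<longleftrightarrow> (\<exists>m\<in>carrier G. \<forall>a\<in>A. right_multiple G m a)"

definition have_common_left_multiple :: "('b, 'c) monoid_scheme \<Rightarrow> 'b set \<Rightarrow> bool" where
  "have_common_left_multiple G A \<longleftrightarrow> (\<exists>m\<in>carrier G. \<forall>a\<in>A. left_multiple G m a)"

definition three_Ore :: "('b, 'c) monoid_scheme \<Rightarrow> bool" where
  "three_Ore G \<longleftrightarrow>
     (\<forall>a\<in>carrier G. \<forall>b\<in>carrier G. \<forall>c\<in>carrier G.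
        have_common_right_multiple G {a, b} \<longrightarrow>
        have_common_right_multiple G {b, c} \<longrightarrow>
        have_common_right_multiple G {a, c} \<longrightarrow>
        have_common_right_multiple G {a, b, c}) \<and>
     (\<forall>a\<in>carrier G. \<forall>b\<in>carrier G. \<forall>c\<in>carrier G.
        have_common_left_multiple G {a, b} \<longrightarrow>
        have_common_left_multiple G {b, c} \<longrightarrow>
        have_common_left_multiple G {a, c} \<longrightarrow>
        have_common_left_multiple G {a, b, c})"

text \<open>
  For generators of an Artin-Tits monoid it does not matter whether common multiples are taken on
  the right or on the left: see \<open>common_multiple_generators\<close> below.
\<close>

definition type_FC :: "'a set \<Rightarrow> ('a list \<times> 'a list) set \<Rightarrow> bool" where
  "type_FC S R \<longleftrightarrow>
     (\<forall>I\<subseteq>S.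
        (\<forall>s\<in>I. \<forall>t\<in>I. have_common_right_multiple (presented_monoid S R)
                        {pres_class S R [s], pres_class S R [t]}) \<longrightarrow>
        spherical_type I (parabolic_relations R I))"

lemma alt_word_Suc: "alt_word s t (Suc n) = alt_word s t n @ [if even n then s else t]"
  by (induction n arbitrary: s t) auto

lemma rev_alt_word: "rev (alt_word s t n) = (if even n then alt_word t s n else alt_word s t n)"
proof (induction n arbitrary: s t)
  case (Suc n)
  have "rev (alt_word s t (Suc n)) = rev (alt_word t s n) @ [s]" by simp
  then show ?case
    using Suc[of t s] alt_word_Suc[of s t n] alt_word_Suc[of t s n]
    by (simp del: alt_word.simps)
qed simp

lemma pres_cong_rev:
  assumes "artin_tits_presentation S R" "(u, v) \<in> pres_cong S R"
  shows "(rev u, rev v) \<in> pres_cong S R"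
  using assms(2)
proof (induction rule: pres_cong.induct)
  case (refl w)
  then show ?case by (intro pres_cong.refl) auto
next
  case (rel u v x y)
  obtain s t n where st: "u = alt_word s t n" "v = alt_word t s n"
    using assms(1) rel.hyps(1) unfolding artin_tits_presentation_def braid_relation_def
    by blast
  have 1: "(rev y @ u @ rev x, rev y @ v @ rev x) \<in> pres_cong S R"
    using rel by (intro pres_cong.rel) auto
  show ?case
  proof (cases "even n")
    case True
    then show ?thesis using pres_cong.sym[OF 1] st by (simp add: rev_alt_word)
  next
    case False
    then show ?thesis using 1 st by (simp add: rev_alt_word)
  qed
next
  case (sym u v)
  then show ?case by (simp add: pres_cong.sym)
next
  case (trans u v w)
  then show ?case using pres_cong.trans by metis
qed

lemma have_common_right_multiple_presented:
  assumes "a \<in> lists S" "b \<in> lists S"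
  shows "have_common_right_multiple (presented_monoid S R) {pres_class S R a, pres_class S R b} \<longleftrightarrow>
    (\<exists>x\<in>lists S. \<exists>y\<in>lists S. (a @ x, b @ y) \<in> pres_cong S R)"
proof -
  have "have_common_right_multiple (presented_monoid S R) {pres_class S R a, pres_class S R b} \<longleftrightarrow>
    (\<exists>m\<in>lists S. (\<exists>x\<in>lists S. (m, a @ x) \<in> pres_cong S R) \<and> (\<exists>y\<in>lists S. (m, b @ y) \<in> pres_cong S R))"
    using assms
    by (simp add: have_common_right_multiple_def right_multiple_def carrier_presented_monoid
        mult_presented_monoid pres_class_eq_iff)
  also have "\<dots> \<longleftrightarrow> (\<exists>x\<in>lists S. \<exists>y\<in>lists S. (a @ x, b @ y) \<in> pres_cong S R)"
    (is "?A \<longleftrightarrow> ?B")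
  proof
    assume ?A
    then show ?B by (meson pres_cong.sym pres_cong.trans)
  next
    assume ?B
    then obtain x y where "x \<in> lists S" "y \<in> lists S" "(a @ x, b @ y) \<in> pres_cong S R"
      by blast
    moreover from this have "a @ x \<in> lists S" using pres_cong_lists by blast
    ultimately show ?A using pres_cong.refl by metis
  qed
  finally show ?thesis .
qed

lemma have_common_left_multiple_presented:
  assumes "a \<in> lists S" "b \<in> lists S"
  shows "have_common_left_multiple (presented_monoid S R) {pres_class S R a, pres_class S R b} \<longleftrightarrow>
    (\<exists>x\<in>lists S. \<exists>y\<in>lists S. (x @ a, y @ b) \<in> pres_cong S R)"
proof -
  have "have_common_left_multiple (presented_monoid S R) {pres_class S R a, pres_class S R b} \<longleftrightarrow>
    (\<exists>m\<in>lists S. (\<exists>x\<in>lists S. (m, x @ a) \<in> pres_cong S R) \<and> (\<exists>y\<in>lists S. (m, y @ b) \<in> pres_cong S R))"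
    using assms
    by (simp add: have_common_left_multiple_def left_multiple_def carrier_presented_monoid
        mult_presented_monoid pres_class_eq_iff)
  also have "\<dots> \<longleftrightarrow> (\<exists>x\<in>lists S. \<exists>y\<in>lists S. (x @ a, y @ b) \<in> pres_cong S R)"
    (is "?A \<longleftrightarrow> ?B")
  proof
    assume ?A
    then show ?B by (meson pres_cong.sym pres_cong.trans)
  next
    assume ?B
    then obtain x y where "x \<in> lists S" "y \<in> lists S" "(x @ a, y @ b) \<in> pres_cong S R"
      by blast
    moreover from this have "x @ a \<in> lists S" using pres_cong_lists by blast
    ultimately show ?A using pres_cong.refl by metis
  qed
  finally show ?thesis .
qed

lemma common_multiple_generators:
  assumes "artin_tits_presentation S R" "s \<in> S" "t \<in> S"
  shows "have_common_right_multiple (presented_monoid S R) {pres_class S R [s], pres_class S R [t]} \<longleftrightarrow>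
         have_common_left_multiple (presented_monoid S R) {pres_class S R [s], pres_class S R [t]}"
proof -
  have "(\<exists>x\<in>lists S. \<exists>y\<in>lists S. ([s] @ x, [t] @ y) \<in> pres_cong S R) \<longleftrightarrow>
        (\<exists>x\<in>lists S. \<exists>y\<in>lists S. (x @ [s], y @ [t]) \<in> pres_cong S R)" (is "?L \<longleftrightarrow> ?R")
  proof
    assume ?L
    then obtain x y where "x \<in> lists S" "y \<in> lists S" "([s] @ x, [t] @ y) \<in> pres_cong S R"
      by blast
    then show ?R
      using pres_cong_rev[OF assms(1), of "[s] @ x" "[t] @ y"]
      by (intro bexI[of _ "rev x"] bexI[of _ "rev y"]) auto
  next
    assume ?R
    then obtain x y where "x \<in> lists S" "y \<in> lists S" "(x @ [s], y @ [t]) \<in> pres_cong S R"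
      by blast
    then show ?L
      using pres_cong_rev[OF assms(1), of "x @ [s]" "y @ [t]"]
      by (intro bexI[of _ "rev x"] bexI[of _ "rev y"]) auto
  qed
  then show ?thesis
    using assms by (simp add: have_common_right_multiple_presented have_common_left_multiple_presented)
qed

end

theory Submission
  imports Defs Complex_Main
begin

text \<open>
  The Coxeter group \<open>W\<close> is controlled by the numbers game, that is, by the dual of Tits' linear
  representation: \<open>s\<close> is an ascent of \<open>w\<close> iff the position reached from the constant position
  \<open>1\<close> by playing \<open>w\<close> is positive at \<open>s\<close>. This gives Matsumoto's theorem, so that \<open>W\<close> is in bijection
  with the classes of reduced words in \<open>M\<close>, the simple elements. From it one obtains that \<open>M\<close> is
  cancellative and that \<open>s x = t y\<close> forces a common factor given by the relation between \<open>s\<close> and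
  \<open>t\<close>, by induction on the length; the critical case of three generators is settled by the join of
  two simple elements. Elements with a common multiple then have an lcm with no new letters.

  If the generators in \<open>I\<close> have an lcm \<open>\<Delta>\<close>, then \<open>s \<Delta> = \<Delta> s'\<close>, every element of \<open>M\<^sub>I\<close>
  divides a power of \<open>\<Delta>\<close> and every simple one divides \<open>\<Delta>\<close>, so \<open>W\<^sub>I\<close> is finite; conversely an element of
  maximal length of a finite \<open>W\<^sub>I\<close> is a common multiple of \<open>I\<close>. Thus type FC means that pairwise
  related generators have a common multiple. The 3-Ore condition clearly implies this. For the
  converse, the elements whose support is a set of pairwise related generators satisfy the 3-Ore
  condition and are closed under complements (two letters without a relation cannot occur
  separately in two elements with a common multiple), and the 3-Ore condition extends from a
  complement-closed generating set to the whole monoid.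
\<close>

section \<open>Alternating words\<close>

lemma length_alt_word [simp]: "length (alt_word s t n) = n"
  by (induction n arbitrary: s t) auto

lemma set_alt_word_subset: "set (alt_word s t n) \<subseteq> {s, t}"
  by (induction n arbitrary: s t) auto

lemma set_alt_word: "2 \<le> n \<Longrightarrow> set (alt_word s t n) = {s, t}"
  using set_alt_word_subset[of s t n]
  by (cases n; cases "n - 1") auto

lemma alt_word_append:
  "alt_word s t (i + j) = alt_word s t i @ (if even i then alt_word s t j else alt_word t s j)"
  by (induction i arbitrary: s t) auto

lemma alt_word_inj:
  assumes "alt_word s t n = alt_word s' t' n'" "2 \<le> n"
  shows "n = n' \<and> s = s' \<and> t = t'"
proof -
  have n: "n = n'"
    using arg_cong[OF assms(1), of length] by simp
  then show ?thesis
    using assms by (cases n; cases "n - 1") auto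
qed

section \<open>Braid and Coxeter equivalence of words\<close>

text \<open>The entry \<open>0\<close> encodes the absence of a relation, so the diagonal entries vanish as well.\<close>

locale braid_matrix =
  fixes m :: "'a \<Rightarrow> 'a \<Rightarrow> nat"
  assumes m_sym: "m s t = m t s"
    and m_ge2: "m s t \<noteq> 0 \<Longrightarrow> s \<noteq> t \<and> 2 \<le> m s t"
begin

text \<open>Words range over the whole type. Letters outside a chosen set of generators do no harm:
  \<open>beq\<close> preserves supports, so it restricts to words over any given set.\<close>

inductive bstep :: "'a list \<Rightarrow> 'a list \<Rightarrow> bool" where
  "m s t \<noteq> 0 \<Longrightarrow> bstep (x @ alt_word s t (m s t) @ y) (x @ alt_word t s (m s t) @ y)"

inductive cstep :: "'a list \<Rightarrow> 'a list \<Rightarrow> bool" where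
  braid: "bstep u v \<Longrightarrow> cstep u v"
| del: "cstep (x @ s # s # y) (x @ y)"
| ins: "cstep (x @ y) (x @ s # s # y)"

definition beq :: "'a list \<Rightarrow> 'a list \<Rightarrow> bool" (infix "\<approx>" 50) where
  "u \<approx> v \<longleftrightarrow> bstep\<^sup>*\<^sup>* u v"

definition ceq :: "'a list \<Rightarrow> 'a list \<Rightarrow> bool" (infix "\<sim>" 50) where
  "u \<sim> v \<longleftrightarrow> cstep\<^sup>*\<^sup>* u v"

lemma bstep_sym: "bstep u v \<Longrightarrow> bstep v u"
  by (induction rule: bstep.induct) (metis bstep.intros m_sym)

lemma cstep_sym: "cstep u v \<Longrightarrow> cstep v u"
  by (induction rule: cstep.induct) (auto intro: cstep.intros bstep_sym)

lemma bstep_context: "bstep u v \<Longrightarrow> bstep (x @ u @ y) (x @ v @ y)"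
proof (induction rule: bstep.induct)
  case (1 s t x' y')
  then show ?case
    using bstep.intros[of s t "x @ x'" "y' @ y"] by simp
qed

lemma cstep_context: "cstep u v \<Longrightarrow> cstep (x @ u @ y) (x @ v @ y)"
proof (induction rule: cstep.induct)
  case (del x' s y')
  then show ?case
    using cstep.del[of "x @ x'" s "y' @ y"] by simp
next
  case (ins x' y' s)
  then show ?case
    using cstep.ins[of "x @ x'" "y' @ y" s] by simp
qed (auto intro: cstep.braid bstep_context)

lemma bstep_length: "bstep u v \<Longrightarrow> length u = length v"
  by (induction rule: bstep.induct) auto

lemma bstep_set: "bstep u v \<Longrightarrow> set u = set v"
proof (induction rule: bstep.induct)
  case (1 s t x y)
  then have "2 \<le> m s t"
    using m_ge2 by blast
  then show ?case
    by (auto simp: set_alt_word)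
qed

lemma bstep_rev: "bstep u v \<Longrightarrow> bstep (rev u) (rev v)"
proof (induction rule: bstep.induct)
  case (1 s t x y)
  then show ?case
    using bstep.intros[of s t "rev y" "rev x"] bstep.intros[of t s "rev y" "rev x"] m_sym[of s t]
    by (auto simp: rev_alt_word)
qed

lemma cstep_rev: "cstep u v \<Longrightarrow> cstep (rev u) (rev v)"
proof (induction rule: cstep.induct)
  case (del x s y)
  then show ?case
    using cstep.del[of "rev y" s "rev x"] by simp
next
  case (ins x y s)
  then show ?case
    using cstep.ins[of "rev y" "rev x" s] by simp
qed (auto intro: cstep.braid bstep_rev)

lemma beq_refl [simp, intro!]: "u \<approx> u"
  by (simp add: beq_def)

lemma beq_trans [trans]: "u \<approx> v \<Longrightarrow> v \<approx> w \<Longrightarrow> u \<approx> w"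
  unfolding beq_def by (rule rtranclp_trans)

lemma beq_sym: "u \<approx> v \<Longrightarrow> v \<approx> u"
  unfolding beq_def by (metis bstep_sym sympD sympI symp_rtranclp)

lemma beq_context: "u \<approx> v \<Longrightarrow> x @ u @ y \<approx> x @ v @ y"
  unfolding beq_def
  by (induction rule: rtranclp_induct) (auto intro: rtranclp.rtrancl_into_rtrancl bstep_context)

lemma beq_append: "u \<approx> u' \<Longrightarrow> v \<approx> v' \<Longrightarrow> u @ v \<approx> u' @ v'"
  using beq_context[of u u' "[]" v] beq_context[of v v' u' "[]"] beq_trans by simp

lemma beq_append_left: "v \<approx> v' \<Longrightarrow> u @ v \<approx> u @ v'"
  by (simp add: beq_append)

lemma beq_append_right: "u \<approx> u' \<Longrightarrow> u @ v \<approx> u' @ v"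
  by (simp add: beq_append)

lemma beq_Cons: "u \<approx> v \<Longrightarrow> a # u \<approx> a # v"
  using beq_append[of "[a]" "[a]" u v] by simp

lemma beq_length: "u \<approx> v \<Longrightarrow> length u = length v"
  unfolding beq_def by (induction rule: rtranclp_induct) (auto dest: bstep_length)

lemma beq_set: "u \<approx> v \<Longrightarrow> set u = set v"
  unfolding beq_def by (induction rule: rtranclp_induct) (auto dest: bstep_set)

lemma beq_rev: "u \<approx> v \<Longrightarrow> rev u \<approx> rev v"
  unfolding beq_def
  by (induction rule: rtranclp_induct) (auto intro: rtranclp.rtrancl_into_rtrancl bstep_rev)

lemma beq_rev_iff: "rev u \<approx> rev v \<longleftrightarrow> u \<approx> v"
  using beq_rev[of u v] beq_rev[of "rev u" "rev v"] by auto

lemma beq_braid: "m s t \<noteq> 0 \<Longrightarrow> alt_word s t (m s t) \<approx> alt_word t s (m s t)"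
  unfolding beq_def using bstep.intros[of s t "[]" "[]"] by auto

lemma ceq_refl [simp, intro!]: "u \<sim> u"
  by (simp add: ceq_def)

lemma ceq_trans [trans]: "u \<sim> v \<Longrightarrow> v \<sim> w \<Longrightarrow> u \<sim> w"
  unfolding ceq_def by (rule rtranclp_trans)

lemma ceq_sym: "u \<sim> v \<Longrightarrow> v \<sim> u"
  unfolding ceq_def by (metis cstep_sym sympD sympI symp_rtranclp)

lemma ceq_context: "u \<sim> v \<Longrightarrow> x @ u @ y \<sim> x @ v @ y"
  unfolding ceq_def
  by (induction rule: rtranclp_induct) (auto intro: rtranclp.rtrancl_into_rtrancl cstep_context)

lemma ceq_append: "u \<sim> u' \<Longrightarrow> v \<sim> v' \<Longrightarrow> u @ v \<sim> u' @ v'"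
  using ceq_context[of u u' "[]" v] ceq_context[of v v' u' "[]"] ceq_trans by simp

lemma ceq_append_left: "v \<sim> v' \<Longrightarrow> u @ v \<sim> u @ v'"
  by (simp add: ceq_append)

lemma ceq_append_right: "u \<sim> u' \<Longrightarrow> u @ v \<sim> u' @ v"
  by (simp add: ceq_append)

lemma ceq_rev: "u \<sim> v \<Longrightarrow> rev u \<sim> rev v"
  unfolding ceq_def
  by (induction rule: rtranclp_induct) (auto intro: rtranclp.rtrancl_into_rtrancl cstep_rev)

lemma beq_imp_ceq: "u \<approx> v \<Longrightarrow> u \<sim> v"
  unfolding beq_def ceq_def
  by (induction rule: rtranclp_induct) (auto intro: rtranclp.rtrancl_into_rtrancl cstep.braid)

lemma ceq_square: "x @ s # s # y \<sim> x @ y"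
  unfolding ceq_def by (auto intro: cstep.del)

lemma ceq_parity: "u \<sim> v \<Longrightarrow> even (length u) \<longleftrightarrow> even (length v)"
  unfolding ceq_def
proof (induction rule: rtranclp_induct)
  case (step v w)
  from step.hyps(2) have "even (length v) \<longleftrightarrow> even (length w)"
    by (induction rule: cstep.induct) (auto dest: bstep_length)
  with step.IH show ?case by simp
qed simp

lemma ceq_rev_append: "rev u @ u \<sim> []"
proof (induction u)
  case (Cons s u)
  have "rev (s # u) @ s # u \<sim> rev u @ u"
    using ceq_square[of "rev u" s u] by simp
  with Cons show ?case
    using ceq_trans by blast
qed simp

lemma ceq_append_cancel_left:
  assumes "w @ u \<sim> w @ v"
  shows "u \<sim> v"
proof -
  have *: "x \<sim> rev w @ w @ x" for x
    using ceq_append_right[OF ceq_rev_append[of w], of x] by (simp add: ceq_sym)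
  have "u \<sim> rev w @ w @ u" by (rule *)
  also have "\<dots> \<sim> rev w @ w @ v"
    using assms by (rule ceq_append_left)
  also have "\<dots> \<sim> v" using * ceq_sym by blast
  finally show ?thesis .
qed

lemma ceq_append_cancel_right:
  assumes "u @ w \<sim> v @ w"
  shows "u \<sim> v"
proof -
  have "rev w @ rev u \<sim> rev w @ rev v"
    using ceq_rev[OF assms] by simp
  then have "rev u \<sim> rev v"
    by (rule ceq_append_cancel_left)
  then show ?thesis
    using ceq_rev by fastforce
qed

section \<open>The length function of the Coxeter group\<close>

definition wlen :: "'a list \<Rightarrow> nat" where
  "wlen u = (LEAST n. \<exists>v. u \<sim> v \<and> length v = n)"

definition red :: "'a list \<Rightarrow> bool" where
  "red u \<longleftrightarrow> wlen u = length u"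

lemma wlen_le: "u \<sim> v \<Longrightarrow> wlen u \<le> length v"
  unfolding wlen_def by (rule Least_le) blast

lemma wlen_le_length: "wlen u \<le> length u"
  using wlen_le by blast

lemma wlen_cong: "u \<sim> v \<Longrightarrow> wlen u = wlen v"
  unfolding wlen_def by (metis ceq_sym ceq_trans)

lemma ex_red: "\<exists>v. u \<sim> v \<and> red v"
proof -
  have "\<exists>v. u \<sim> v \<and> length v = wlen u"
    unfolding wlen_def by (rule LeastI_ex) blast
  then show ?thesis
    unfolding red_def using wlen_cong by metis
qed

lemma red_beq: "u \<approx> v \<Longrightarrow> red u \<longleftrightarrow> red v"
  unfolding red_def using beq_length beq_imp_ceq wlen_cong by metis

lemma wlen_append: "wlen (u @ v) \<le> wlen u + wlen v"
proof -
  obtain u' v' where *: "u \<sim> u'" "red u'" "v \<sim> v'" "red v'"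
    using ex_red by blast
  have "wlen (u @ v) \<le> length (u' @ v')"
    using * by (intro wlen_le ceq_append)
  then show ?thesis
    using * wlen_cong unfolding red_def by (metis length_append)
qed

lemma red_appendD:
  assumes "red (u @ v)"
  shows "red u" "red v"
  using assms wlen_append[of u v] wlen_le_length[of u] wlen_le_length[of v]
  unfolding red_def by auto

lemma red_Nil [simp]: "red []"
  unfolding red_def using wlen_le_length[of "[]"] by simp

lemma wlen_rev: "wlen (rev u) = wlen u"
proof -
  have *: "wlen (rev w) \<le> wlen w" for w
  proof -
    obtain v where "w \<sim> v" "red v"
      using ex_red by blast
    then show ?thesis
      using wlen_le[OF ceq_rev[of w v]] wlen_cong[of w v] unfolding red_def by simp
  qed
  show ?thesis using *[of u] *[of "rev u"] by simp
qed

lemma red_rev: "red (rev u) \<longleftrightarrow> red u"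
  by (simp add: red_def wlen_rev)

lemma wlen_parity: "even (wlen u) \<longleftrightarrow> even (length u)"
proof -
  obtain v where "u \<sim> v" "red v"
    using ex_red by blast
  then show ?thesis
    using ceq_parity[of u v] wlen_cong[of u v] by (simp add: red_def)
qed

lemma wlen_snoc_square: "wlen (u @ [s, s]) = wlen u"
  using wlen_cong[OF ceq_square[of u s "[]"]] by simp

text \<open>A letter changes the length by at most one since its square is trivial, and does change
  it since braid relations and squares preserve the parity of the length of a word.\<close>

lemma wlen_snoc: "wlen (u @ [s]) = Suc (wlen u) \<or> wlen u = Suc (wlen (u @ [s]))"
proof -
  have 1: "wlen (v @ [s]) \<le> Suc (wlen v)" for v
    using wlen_append[of v "[s]"] wlen_le_length[of "[s]"] by simp
  have "wlen u \<le> Suc (wlen (u @ [s]))"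
    using 1[of "u @ [s]"] wlen_snoc_square[of u s] by simp
  moreover have "wlen (u @ [s]) \<noteq> wlen u"
    using wlen_parity[of u] wlen_parity[of "u @ [s]"] by auto
  ultimately show ?thesis using 1[of u] by linarith
qed

abbreviation ascent :: "'a list \<Rightarrow> 'a \<Rightarrow> bool" where
  "ascent u s \<equiv> wlen (u @ [s]) = Suc (wlen u)"

lemma descentE:
  assumes "\<not> ascent u s"
  obtains v where "u \<sim> v @ [s]" "red v" "wlen u = Suc (wlen v)"
proof -
  obtain v where v: "u @ [s] \<sim> v" "red v"
    using ex_red by blast
  have "u \<sim> u @ [s, s]"
    using ceq_square[of u s "[]"] by (simp add: ceq_sym)
  also have "\<dots> \<sim> v @ [s]"
    using ceq_append_right[OF v(1), of "[s]"] by simp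
  finally have "u \<sim> v @ [s]" .
  moreover have "wlen u = Suc (wlen v)"
    using wlen_snoc[of u s] assms wlen_cong[OF v(1)] by auto
  ultimately show ?thesis using that v(2) by blast
qed

lemma ascent_cong: "u \<sim> v \<Longrightarrow> ascent u s \<longleftrightarrow> ascent v s"
  using wlen_cong[of u v] wlen_cong[OF ceq_append_right[of u v "[s]"]] by simp

lemma red_snoc: "red (u @ [s]) \<longleftrightarrow> red u \<and> ascent u s"
  using red_appendD(1)[of u "[s]"] unfolding red_def by auto

text \<open>\<open>v\<close> is a shortest element of the coset of \<open>u\<close> modulo the
  subgroup generated by \<open>s\<close> and \<open>t\<close>, found by stripping descents in
  \<open>{s, t}\<close>. The stripped letters alternate, since equal neighbours would cancel and
  make \<open>u\<close> too short.\<close>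

lemma dihedral_coset:
  "\<exists>v k p q. {p, q} = {s, t} \<and> u \<sim> v @ alt_word p q k \<and> wlen u = wlen v + k
     \<and> ascent v s \<and> ascent v t"
proof (induction "wlen u" arbitrary: u rule: less_induct)
  case less
  show ?case
  proof (cases "ascent u s \<and> ascent u t")
    case True
    then show ?thesis
      by (intro exI[of _ u] exI[of _ 0] exI[of _ s] exI[of _ t]) auto
  next
    case False
    then obtain r where r: "r \<in> {s, t}" "\<not> ascent u r" by blast
    obtain u' where u': "u \<sim> u' @ [r]" "wlen u = Suc (wlen u')"
      using descentE[OF r(2)] by metis
    obtain v k p q where v: "{p, q} = {s, t}" "u' \<sim> v @ alt_word p q k" "wlen u' = wlen v + k"
        "ascent v s" "ascent v t"
      using less[of u'] u'(2) by auto
    have u: "u \<sim> v @ alt_word p q k @ [r]"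
      using ceq_trans[OF u'(1) ceq_append_right[OF v(2)]] by simp
    show ?thesis
    proof (cases k)
      case 0
      obtain r' where "{r, r'} = {s, t}" using r(1) by blast
      then show ?thesis
        using u u'(2) v 0
        by (intro exI[of _ v] exI[of _ 1] exI[of _ r] exI[of _ r']) auto
    next
      case (Suc j)
      have "r \<noteq> (if even j then p else q)"
      proof
        assume "r = (if even j then p else q)"
        then have "u \<sim> v @ alt_word p q j @ [r, r]"
          using u Suc by (simp only: alt_word_Suc) simp
        then have "u \<sim> v @ alt_word p q j"
          using ceq_square[of "v @ alt_word p q j" r "[]"] ceq_trans by simp
        then have "wlen u \<le> wlen v + j"
          using wlen_cong[of u] wlen_append[of v "alt_word p q j"] wlen_le_length[of "alt_word p q j"]
          by fastforce
        then show False
          using u'(2) v(3) Suc by simp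
      qed
      then have "r = (if even k then p else q)"
        using r(1) v(1) Suc by (auto split: if_splits)
      then have "alt_word p q k @ [r] = alt_word p q (Suc k)"
        by (simp only: alt_word_Suc)
      then have "u \<sim> v @ alt_word p q (Suc k)" "wlen u = wlen v + Suc k"
        using u u'(2) v(3) by (simp_all del: alt_word.simps)
      then show ?thesis
        using v by blast
    qed
  qed
qed

end

section \<open>The numbers game\<close>

text \<open>Chebyshev polynomials of the second kind at c/2, with the index shifted by one:
  \<open>cheb c k\<close> is U_{k-1}(c/2). They are the coefficients that arise when two generators
  are fired in turn.\<close>

fun cheb :: "real \<Rightarrow> nat \<Rightarrow> real" where
  "cheb c 0 = 0"
| "cheb c (Suc 0) = 1"
| "cheb c (Suc (Suc k)) = c * cheb c (Suc k) - cheb c k"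

lemma cheb_cos: "cheb (2 * cos x) k * sin x = sin (real k * x)"
proof (induction "2 * cos x" k rule: cheb.induct)
  case (3 k)
  have "sin (real (Suc (Suc k)) * x) + sin (real k * x) = 2 * cos x * sin (real (Suc k) * x)"
    using sin_add[of "real (Suc k) * x" x] sin_diff[of "real (Suc k) * x" x]
    by (simp add: algebra_simps)
  with 3 show ?case
    by (simp add: algebra_simps)
qed auto

lemma cheb_2: "cheb 2 k = real k"
  by (induction "2 :: real" k rule: cheb.induct) auto

context braid_matrix
begin

text \<open>Twice the canonical bilinear form on simple roots; a missing relation counts as order
  infinity, where the cosine becomes 1.\<close>

definition cf :: "'a \<Rightarrow> 'a \<Rightarrow> real" where
  "cf s t = (if s = t then 2 else if m s t = 0 then - 2 else - 2 * cos (pi / m s t))"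

text \<open>A position is a linear functional given by its values on the simple roots, and firing
  \<open>s\<close> composes it with the reflection of \<open>s\<close>. So \<open>play f w u\<close>
  is the value of \<open>f\<close> at the root that the product of \<open>w\<close> makes of the
  simple root of \<open>u\<close>.\<close>

definition fire :: "'a \<Rightarrow> ('a \<Rightarrow> real) \<Rightarrow> 'a \<Rightarrow> real" where
  "fire s f = (\<lambda>u. f u - cf s u * f s)"

definition play :: "('a \<Rightarrow> real) \<Rightarrow> 'a list \<Rightarrow> 'a \<Rightarrow> real" where
  "play f w = fold fire w f"

lemma cf_sym: "cf s t = cf t s"
  by (simp add: cf_def m_sym)

lemma cf_self [simp]: "cf s s = 2"
  by (simp add: cf_def)

lemma play_Nil [simp]: "play f [] = f"
  by (simp add: play_def)

lemma play_Cons [simp]: "play f (s # w) = play (fire s f) w"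
  by (simp add: play_def)

lemma play_append [simp]: "play f (u @ v) = play (play f u) v"
  by (simp add: play_def)

lemma fire_fire [simp]: "fire s (fire s f) = f"
  by (auto simp: fire_def)

text \<open>With x = pi/m the numbers sin(kx)/sin(x) are positive for 0 < k < m, vanish at k = m and
  equal -1 at k = m+1. The last claim says that the form of rank two on \<open>s\<close> and
  \<open>t\<close> is nondegenerate.\<close>

lemma cheb_cf_finite:
  assumes "m s t \<noteq> 0"
  shows "cheb (- cf s t) (m s t) = 0" "cheb (- cf s t) (Suc (m s t)) = - 1"
    and "0 < k \<Longrightarrow> k < m s t \<Longrightarrow> 0 < cheb (- cf s t) k"
    and "(cf s t)\<^sup>2 < 4"
proof -
  define x where "x = pi / m s t"
  have m: "s \<noteq> t" "2 \<le> m s t" using m_ge2 assms by auto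
  then have c: "- cf s t = 2 * cos x"
    using assms by (simp add: cf_def x_def)
  have "x < pi" "0 < x"
    using m by (auto simp: x_def field_simps)
  then have pos: "0 < sin x" by (rule sin_gt_zero[rotated])
  have mx: "real (m s t) * x = pi"
    using assms by (simp add: x_def)
  show "cheb (- cf s t) (m s t) = 0"
    using cheb_cos[of x "m s t"] pos mx by (simp add: c)
  have "sin (real (Suc (m s t)) * x) = - sin x"
    using mx by (simp add: distrib_right)
  then show "cheb (- cf s t) (Suc (m s t)) = - 1"
    using cheb_cos[of x "Suc (m s t)"] pos unfolding c
    by (metis mult_cancel_right mult_minus1 less_irrefl)
  show "0 < cheb (- cf s t) k" if k: "0 < k" "k < m s t"
  proof -
    have "real k * x < pi"
      using mult_strict_right_mono[of "real k" "real (m s t)" x] k mx \<open>0 < x\<close> by simp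
    then have "0 < sin (real k * x)"
      using k \<open>0 < x\<close> by (intro sin_gt_zero) auto
    then show ?thesis
      using cheb_cos[of x k] pos unfolding c by (metis zero_less_mult_pos2)
  qed
  have "(cf s t)\<^sup>2 = (- cf s t)\<^sup>2" by simp
  also have "\<dots> = 4 * (cos x)\<^sup>2"
    unfolding c by (simp add: power_mult_distrib)
  finally have "(cf s t)\<^sup>2 = 4 - 4 * (sin x)\<^sup>2"
    by (simp add: cos_squared_eq)
  then show "(cf s t)\<^sup>2 < 4"
    using pos by simp
qed

text \<open>The first equation concerns the letter that would be fired next. In the second,
  \<open>c * cheb c k - cheb c (Suc k)\<close> stands for the coefficient with index k-1 and has the
  right value -1 at k = 0.\<close>

lemma play_alt_word:
  assumes "s \<noteq> t"
  defines "c \<equiv> - cf s t"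
  shows "play f (alt_word s t k) (if even k then s else t)
           = cheb c (Suc k) * f s + cheb c k * f t
       \<and> play f (alt_word s t k) (if even k then t else s)
           = - (cheb c k * f s + (c * cheb c k - cheb c (Suc k)) * f t)"
proof (induction k)
  case (Suc k)
  define p where "p = (if even k then s else t)"
  define q where "q = (if even k then t else s)"
  define g where "g = play f (alt_word s t k)"
  have IH: "g p = cheb c (Suc k) * f s + cheb c k * f t"
      "g q = - (cheb c k * f s + (c * cheb c k - cheb c (Suc k)) * f t)"
    using Suc by (auto simp: g_def p_def q_def)
  have play: "play f (alt_word s t (Suc k)) = fire p g"
    by (simp add: alt_word_Suc g_def p_def del: alt_word.simps)
  have "fire p g p = - g p"
    by (simp add: fire_def)
  moreover have "fire p g q = g q + c * g p"
    using cf_sym[of s t] by (auto simp: fire_def c_def p_def q_def)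
  moreover have "(if even (Suc k) then s else t) = q" "(if even (Suc k) then t else s) = p"
    by (auto simp: p_def q_def)
  ultimately show ?case
    unfolding play by (simp add: IH algebra_simps)
qed simp

text \<open>
  On the coordinates \<open>s\<close> and \<open>t\<close> both sides of a braid relation are evaluated explicitly; any
  other coordinate \<open>u\<close> is recovered from the functional \<open>f u + \<alpha> f s + \<beta> f t\<close>, which is
  invariant under firing \<open>s\<close> and \<open>t\<close>.
\<close>

lemma play_braid:
  assumes "m s t \<noteq> 0"
  shows "play f (alt_word s t (m s t)) = play f (alt_word t s (m s t))"
proof
  fix u
  have st: "s \<noteq> t" using m_ge2 assms by blast
  note U = cheb_cf_finite(1,2)[OF assms]
  let ?a = "play f (alt_word s t (m s t))" and ?b = "play f (alt_word t s (m s t))"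
  have *: "?a s = ?b s \<and> ?a t = ?b t"
    using play_alt_word[OF st, of f "m s t"] play_alt_word[OF st[symmetric], of f "m s t"] U
      cf_sym[of t s]
    by (auto split: if_splits)
  define c where "c = cf s t"
  \<comment> \<open>The determinant of the linear system \<open>1\<close>, \<open>2\<close>, which
    expresses invariance under both firings; \<open>\<alpha>\<close> and \<open>\<beta>\<close> are
    its solution by Cramer's rule.\<close>
  define d where "d = 4 - c\<^sup>2"
  define \<alpha> where "\<alpha> = (c * cf t u - 2 * cf s u) / d"
  define \<beta> where "\<beta> = (c * cf s u - 2 * cf t u) / d"
  have d: "d \<noteq> 0"
    using cheb_cf_finite(4)[OF assms] by (simp add: d_def c_def)
  have 1: "2 * \<alpha> + c * \<beta> = - cf s u"
    using d unfolding \<alpha>_def \<beta>_def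
    by (simp add: divide_simps) (simp add: d_def algebra_simps power2_eq_square)
  have 2: "c * \<alpha> + 2 * \<beta> = - cf t u"
    using d unfolding \<alpha>_def \<beta>_def
    by (simp add: divide_simps) (simp add: d_def algebra_simps power2_eq_square)
  define \<phi> where "\<phi> g = g u + \<alpha> * g s + \<beta> * g t" for g :: "'a \<Rightarrow> real"
  have "\<phi> (fire s g) = \<phi> g - g s * (cf s u + (2 * \<alpha> + c * \<beta>))" for g
    by (simp add: \<phi>_def fire_def c_def algebra_simps)
  then have s: "\<phi> (fire s g) = \<phi> g" for g
    by (simp add: 1)
  have "\<phi> (fire t g) = \<phi> g - g t * (cf t u + (c * \<alpha> + 2 * \<beta>))" for g
    using cf_sym[of t s] by (simp add: \<phi>_def fire_def c_def algebra_simps)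
  then have t: "\<phi> (fire t g) = \<phi> g" for g
    by (simp add: 2)
  have inv: "\<phi> (play g w) = \<phi> g" if "set w \<subseteq> {s, t}" for g w
    using that by (induction w arbitrary: g) (auto simp: s t)
  have "\<phi> ?a = \<phi> ?b"
    using inv[of _ f] set_alt_word_subset[of s t "m s t"] set_alt_word_subset[of t s "m s t"]
    by (simp add: insert_commute)
  then show "?a u = ?b u"
    using * by (simp add: \<phi>_def)
qed

lemma play_ceq: "u \<sim> v \<Longrightarrow> play f u = play f v"
  unfolding ceq_def
proof (induction rule: rtranclp_induct)
  case (step v w)
  have "play f v = play f w"
    using step.hyps(2)
  proof (induction rule: cstep.induct)
    case (braid u v)
    then show ?case
    proof (induction rule: bstep.induct)
      case (1 s t x y)
      then show ?case
        using play_braid[of s t "play f x"] by simp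
    qed
  qed auto
  then show ?case using step.IH by simp
qed simp

text \<open>At k = m-1 the first coefficient vanishes, but the second is positive since m is at
  least 2. Without a relation the coefficients are k+1 and k.\<close>

lemma cheb_combination_pos:
  assumes "s \<noteq> t" "m s t = 0 \<or> k < m s t" "0 < x" "0 < y"
  shows "0 < cheb (- cf s t) (Suc k) * x + cheb (- cf s t) k * y"
proof (cases "m s t = 0")
  case True
  then have "- cf s t = 2" using assms(1) by (simp add: cf_def)
  then show ?thesis
    using assms(3,4) by (simp add: cheb_2 add_pos_nonneg del: cheb.simps)
next
  case False
  note U = cheb_cf_finite[OF False]
  show ?thesis
  proof (cases "k = 0")
    case True
    then show ?thesis using assms(3) by simp
  next
    case False
    then have "0 < cheb (- cf s t) k"
      using assms(2) \<open>m s t \<noteq> 0\<close> U(3) by simp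
    moreover have "0 \<le> cheb (- cf s t) (Suc k)"
      using assms(2) \<open>m s t \<noteq> 0\<close> U(1) U(3)[of "Suc k"]
      by (cases "Suc k = m s t") auto
    ultimately show ?thesis
      using assms(3,4) by (simp add: add_nonneg_pos del: cheb.simps)
  qed
qed

section \<open>Tits' sign criterion for ascents\<close>

abbreviation val :: "'a list \<Rightarrow> 'a \<Rightarrow> real" where
  "val u \<equiv> play (\<lambda>_. 1) u"

lemma not_ascentI:
  assumes "u \<sim> v @ [s]" "wlen v < wlen u"
  shows "\<not> ascent u s"
  using wlen_cong[OF ceq_append_right[OF assms(1), of "[s]"]] wlen_snoc_square[of v s] assms(2)
  by simp

lemma wlen_append_alt_word_le: "wlen (v @ alt_word p q k) \<le> wlen v + k"
  using wlen_append[of v "alt_word p q k"] wlen_le_length[of "alt_word p q k"] by simp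

text \<open>A braid relation applied to the last \<open>m p q\<close> letters makes the word end in
  the letter that would continue the alternation, so appending that letter shortens it.\<close>

lemma not_ascent_append_alt_word:
  assumes "m p q \<noteq> 0" "m p q \<le> k" "wlen (v @ alt_word p q k) = wlen v + k"
  shows "\<not> ascent (v @ alt_word p q k) (if even k then p else q)"
proof -
  define w where "w = alt_word p q (k - m p q)"
  define p' where "p' = (if even (k - m p q) then p else q)"
  define q' where "q' = (if even (k - m p q) then q else p)"
  have m: "m p' q' = m p q" by (simp add: p'_def q'_def m_sym)
  obtain n where n: "m p q = Suc n" using assms(1) not0_implies_Suc by blast
  have "alt_word p q k = w @ alt_word p' q' (m p q)"
    using alt_word_append[of p q "k - m p q" "m p q"] assms(2)
    by (simp add: w_def p'_def q'_def)
  then have "v @ alt_word p q k \<sim> (v @ w) @ alt_word q' p' (m p q)"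
    using beq_imp_ceq[OF beq_braid[of p' q']] assms(1) m
    by (simp add: ceq_append_left)
  also have "alt_word q' p' (m p q) = alt_word q' p' n @ [if even k then p else q]"
    using assms(2) by (auto simp: n alt_word_Suc p'_def q'_def simp del: alt_word.simps)
  finally have *: "v @ alt_word p q k \<sim> (v @ w @ alt_word q' p' n) @ [if even k then p else q]"
    by simp
  have "length w + n < k"
    using assms(2) by (simp add: w_def n)
  then have "wlen (v @ w @ alt_word q' p' n) < wlen v + k"
    using wlen_append[of v "w @ alt_word q' p' n"] wlen_le_length[of "w @ alt_word q' p' n"]
    by simp
  then show ?thesis
    using not_ascentI[OF *] assms(3) by simp
qed

text \<open>If \<open>u\<close> is nontrivial it has a descent \<open>t\<close>. Split off the
  alternating part of \<open>u\<close> in \<open>s\<close> and \<open>t\<close>; the rest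
  \<open>v\<close> is shorter and has both as ascents, so \<open>val v\<close> is positive there. As
  \<open>s\<close> is an ascent of \<open>u\<close>, the alternating part ends in \<open>t\<close>
  and is shorter than the braid word, so positivity is inherited.\<close>

theorem val_pos: "ascent u s \<Longrightarrow> 0 < val u s"
proof (induction "wlen u" arbitrary: u s rule: less_induct)
  case less
  show ?case
  proof (cases "\<exists>t. \<not> ascent u t")
    case False
    have "u \<sim> []"
    proof -
      obtain v where v: "u \<sim> v" "red v" using ex_red by blast
      have "v = []"
      proof (rule ccontr)
        assume "v \<noteq> []"
        then obtain w t where w: "v = w @ [t]" by (metis rev_exhaust)
        have "\<not> ascent v t"
          using wlen_snoc_square[of w t] v(2) wlen_le_length[of w] by (simp add: w red_def)
        then show False using False ascent_cong[OF v(1)] by blast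
      qed
      then show ?thesis using v(1) by simp
    qed
    then show ?thesis using play_ceq by fastforce
  next
    case True
    then obtain t where t: "\<not> ascent u t" by blast
    then have "s \<noteq> t" using less.prems by blast
    obtain v k p q where v: "{p, q} = {s, t}" "u \<sim> v @ alt_word p q k" "wlen u = wlen v + k"
        "ascent v s" "ascent v t"
      using dihedral_coset[of s t u] by (elim exE conjE) (rule that)
    have "k \<noteq> 0"
    proof
      assume "k = 0"
      then have "u \<sim> v" using v(2) by simp
      then show False using ascent_cong[of u v t] v(5) t by blast
    qed
    then have val: "0 < val v s" "0 < val v t"
      using less.hyps[of v] v by auto
    obtain j where j: "k = Suc j" using \<open>k \<noteq> 0\<close> not0_implies_Suc by blast
    have "s \<noteq> (if even j then p else q)"
    proof
      assume "s = (if even j then p else q)"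
      then have "u \<sim> (v @ alt_word p q j) @ [s]"
        using v(2) by (simp add: j alt_word_Suc del: alt_word.simps)
      then have "\<not> ascent u s"
        using wlen_append_alt_word_le[of v p q j] v(3) j
        by (intro not_ascentI[of u "v @ alt_word p q j"]) auto
      then show False using less.prems by simp
    qed
    then have s: "s = (if even k then p else q)"
      using v(1) by (auto simp: j split: if_splits)
    have pq: "p \<noteq> q" using v(1) \<open>s \<noteq> t\<close> by auto
    have "m p q = 0 \<or> k < m p q"
      using not_ascent_append_alt_word[of p q k v] less.prems ascent_cong[OF v(2), of s] s v(3)
        wlen_cong[OF v(2)] by fastforce
    then have "0 < cheb (- cf p q) (Suc k) * val v p + cheb (- cf p q) k * val v q"
      using val v(1) by (intro cheb_combination_pos pq) (auto simp: doubleton_eq_iff)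
    also have "\<dots> = val u s"
      using play_alt_word[OF pq, of "val v" k] play_ceq[OF v(2)] by (simp add: s)
    finally show ?thesis .
  qed
qed

text \<open>If \<open>s\<close> is not an ascent of \<open>u\<close>, it is one of
  \<open>u @ [s]\<close>, and firing \<open>s\<close> changes the sign at \<open>s\<close>.\<close>

lemma ascent_iff: "ascent u s \<longleftrightarrow> 0 < val u s"
proof
  assume *: "0 < val u s"
  show "ascent u s"
  proof (rule ccontr)
    assume "\<not> ascent u s"
    then have "ascent (u @ [s]) s"
      using wlen_snoc[of u s] wlen_snoc_square[of u s] by auto
    then have "0 < val (u @ [s]) s" by (rule val_pos)
    then show False using * by (simp add: fire_def)
  qed
qed (rule val_pos)

section \<open>Reduced words\<close>

lemma wlen_append_alt_word:
  assumes "s \<noteq> t" "ascent v s" "ascent v t" "m s t = 0 \<or> k \<le> m s t"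
  shows "wlen (v @ alt_word s t k) = wlen v + k"
  using assms(4)
proof (induction k)
  case (Suc k)
  have "0 < cheb (- cf s t) (Suc k) * val v s + cheb (- cf s t) k * val v t"
    using assms Suc.prems by (intro cheb_combination_pos) (auto simp: ascent_iff)
  then have "ascent (v @ alt_word s t k) (if even k then s else t)"
    using play_alt_word[OF assms(1), of "val v" k] unfolding ascent_iff by simp
  then show ?case
    using Suc.IH Suc.prems by (auto simp add: alt_word_Suc simp del: alt_word.simps)
qed simp

lemma red_append_alt_word:
  assumes "s \<noteq> t" "red (v @ [s])" "red (v @ [t])" "m s t = 0 \<or> k \<le> m s t"
  shows "red (v @ alt_word s t k)"
  using wlen_append_alt_word[OF assms(1) _ _ assms(4), of v] assms(2,3)
  unfolding red_snoc by (simp add: red_def)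

text \<open>In the dihedral decomposition of \<open>u\<close> a tail shorter than the braid word
  would leave \<open>s\<close> or \<open>t\<close> as an ascent, and a longer one would not be
  reduced. Hence the tail is the braid word itself.\<close>

lemma ex_braid_suffix:
  assumes "s \<noteq> t" "\<not> ascent u s" "\<not> ascent u t"
  shows "m s t \<noteq> 0 \<and> (\<exists>v. red v \<and> u \<sim> v @ alt_word s t (m s t) \<and> wlen u = length v + m s t)"
proof -
  obtain v k p q where v: "{p, q} = {s, t}" "u \<sim> v @ alt_word p q k" "wlen u = wlen v + k"
      "ascent v s" "ascent v t"
    using dihedral_coset[of s t u] by (elim exE conjE) (rule that)
  have pq: "p \<noteq> q" "m p q = m s t" and asc: "ascent v p" "ascent v q"
    using v assms(1) m_sym by (auto simp: doubleton_eq_iff)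
  have "\<not> (m p q = 0 \<or> k < m p q)"
  proof
    assume *: "m p q = 0 \<or> k < m p q"
    define r where "r = (if even k then p else q)"
    have "wlen (u @ [r]) = wlen (v @ alt_word p q (Suc k))"
      using wlen_cong[OF ceq_append_right[OF v(2), of "[r]"]]
      by (simp add: alt_word_Suc r_def del: alt_word.simps)
    also have "\<dots> = wlen v + Suc k"
      using * asc pq by (intro wlen_append_alt_word) auto
    finally have "ascent u r" using v(3) by simp
    moreover have "r \<in> {s, t}" using v(1) by (auto simp: r_def)
    ultimately show False using assms by auto
  qed
  moreover have "k \<le> m p q"
  proof (rule ccontr)
    assume "\<not> k \<le> m p q"
    then obtain j where j: "k = Suc j" "m p q \<le> j"
      by (metis not_less_eq_eq not0_implies_Suc zero_le)
    have len: "wlen (v @ alt_word p q k) = wlen v + k"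
      using v(3) wlen_cong[OF v(2)] by simp
    have snoc: "v @ alt_word p q k = (v @ alt_word p q j) @ [if even j then p else q]"
      by (simp add: j(1) alt_word_Suc del: alt_word.simps)
    have "wlen (v @ alt_word p q j) = wlen v + j"
      using len wlen_append_alt_word_le[of v p q j] j(1)
        wlen_snoc[of "v @ alt_word p q j" "if even j then p else q"]
      unfolding snoc by linarith
    then show False
      using not_ascent_append_alt_word[of p q j v] j \<open>\<not> (m p q = 0 \<or> k < m p q)\<close> len
      unfolding snoc by simp
  qed
  ultimately have k: "k = m s t" "m s t \<noteq> 0"
    using pq(2) by auto
  have "alt_word p q k \<approx> alt_word s t (m s t)"
    using v(1) assms(1) beq_sym[OF beq_braid[OF k(2)]] k(1) by (auto simp: doubleton_eq_iff)
  moreover obtain v' where v': "v \<sim> v'" "red v'" using ex_red by blast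
  ultimately have "u \<sim> v' @ alt_word s t (m s t)"
    using ceq_trans[OF v(2) ceq_append] beq_imp_ceq by blast
  moreover have "wlen u = length v' + m s t"
    using v(3) k(1) v' wlen_cong[OF v'(1)] by (simp add: red_def)
  ultimately show ?thesis using k(2) v'(2) by blast
qed

lemma red_ceq_length: "red u \<Longrightarrow> u \<sim> v \<Longrightarrow> length u = length v \<Longrightarrow> red v"
  using wlen_cong unfolding red_def by metis

lemma not_ascent_snoc: "red (u @ [s]) \<Longrightarrow> \<not> ascent (u @ [s]) s"
  using wlen_snoc_square[of u s] wlen_le_length[of u] unfolding red_def by simp

text \<open>If the last letters agree, cancel them. Otherwise both are descents, so the element has
  a reduced word ending in the braid word of \<open>s\<close> and \<open>t\<close>; its two forms
  end in \<open>s\<close> and in \<open>t\<close>, and by induction they are braid equivalent to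
  \<open>u\<close> and \<open>v\<close>.\<close>

theorem matsumoto: "red u \<Longrightarrow> red v \<Longrightarrow> u \<sim> v \<Longrightarrow> u \<approx> v"
proof (induction "length u" arbitrary: u v rule: less_induct)
  case less
  have len: "length u = length v"
    using less.prems wlen_cong unfolding red_def by metis
  show ?case
  proof (cases u rule: rev_cases)
    case Nil
    then show ?thesis using len by simp
  next
    case u: (snoc u' s)
    then obtain v' t where v: "v = v' @ [t]"
      using len by (cases v rule: rev_cases) auto
    have red': "red u'" "red v'"
      using less.prems red_appendD(1) u v by blast+
    show ?thesis
    proof (cases "s = t")
      case True
      then have "u' \<sim> v'"
        using less.prems(3) ceq_append_cancel_right u v by blast
      then show ?thesis
        using less.hyps[of u' v'] red' u v True beq_append_right by simp
    next
      case False
      have "\<not> ascent u s" "\<not> ascent u t"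
        using not_ascent_snoc less.prems u v ascent_cong by blast+
      then obtain z where m: "m s t \<noteq> 0" and z: "red z" "u \<sim> z @ alt_word s t (m s t)"
          "length u = length z + m s t"
        using ex_braid_suffix[OF False] less.prems(1) unfolding red_def by metis
      obtain n where n: "m s t = Suc n" using m not0_implies_Suc by blast
      \<comment> \<open>Chosen by parity so that the braid word starting with \<open>p\<close> ends
        in \<open>s\<close> and the one starting with \<open>q\<close> ends in
        \<open>t\<close>.\<close>
      define p where "p = (if even n then s else t)"
      define q where "q = (if even n then t else s)"
      have pq: "alt_word p q (Suc n) \<approx> alt_word q p (Suc n)"
          "alt_word s t (m s t) \<approx> alt_word p q (Suc n)"
        using beq_braid[OF m] beq_sym[OF beq_braid[OF m]] by (auto simp: p_def q_def n)
      have zp: "u \<sim> z @ alt_word p q (Suc n)" and zq: "u \<sim> z @ alt_word q p (Suc n)"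
        using z(2) beq_imp_ceq pq ceq_append_left ceq_trans by metis+
      have sp: "alt_word p q (Suc n) = alt_word p q n @ [s]"
        and tq: "alt_word q p (Suc n) = alt_word q p n @ [t]"
        by (auto simp only: alt_word_Suc p_def q_def split: if_splits)
      have "u' \<sim> z @ alt_word p q n"
        using zp ceq_append_cancel_right[of u' "[s]" "z @ alt_word p q n"] by (simp only: sp u) simp
      moreover have "red (z @ alt_word p q n)"
        using red_ceq_length[OF less.prems(1) zp] z(3) red_appendD(1)[of "z @ alt_word p q n" "[s]"]
        by (simp only: sp n) simp
      ultimately have 1: "u' \<approx> z @ alt_word p q n"
        using less.hyps red' u by simp
      have "v \<sim> z @ alt_word q p (Suc n)"
        using zq less.prems(3) ceq_sym ceq_trans by blast
      then have "v' \<sim> z @ alt_word q p n"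
        using ceq_append_cancel_right[of v' "[t]" "z @ alt_word q p n"] by (simp only: tq v) simp
      moreover have "red (z @ alt_word q p n)"
        using red_ceq_length[OF less.prems(1) zq] z(3) red_appendD(1)[of "z @ alt_word q p n" "[t]"]
        by (simp only: tq n) simp
      ultimately have 2: "v' \<approx> z @ alt_word q p n"
        using less.hyps[of v'] red' u v len by simp
      have "u \<approx> z @ alt_word p q (Suc n)"
        using beq_append_right[OF 1, of "[s]"] by (simp only: sp u) simp
      also have "\<dots> \<approx> z @ alt_word q p (Suc n)"
        using pq(1) by (rule beq_append_left)
      also have "\<dots> \<approx> v"
        using beq_append_right[OF beq_sym[OF 2], of "[t]"] by (simp only: tq v) simp
      finally show ?thesis .
    qed
  qed
qed


section \<open>Cancellation and common multiples of generators\<close>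

definition lprefix :: "'a list \<Rightarrow> 'a list \<Rightarrow> bool" (infix "\<preceq>" 50) where
  "u \<preceq> v \<longleftrightarrow> (\<exists>x. u @ x \<approx> v)"

text \<open>What \<open>a\<close> lacks to become the lcm of \<open>a\<close> and \<open>b\<close>;
  the dummy value is \<open>[]\<close> when there is no relation.\<close>

definition cpl :: "'a \<Rightarrow> 'a \<Rightarrow> 'a list" where
  "cpl a b = alt_word b a (m a b - 1)"

text \<open>The only ways in which \<open>a # X\<close> and \<open>b # Y\<close> can be equal in the
  monoid, as \<open>beq_Cons_head_rel\<close> will show. The case \<open>a = b\<close> is left
  cancellation.\<close>

definition head_rel :: "'a \<Rightarrow> 'a list \<Rightarrow> 'a \<Rightarrow> 'a list \<Rightarrow> bool" where
  "head_rel a X b Y \<longleftrightarrow>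
     a = b \<and> X \<approx> Y \<or> m a b \<noteq> 0 \<and> (\<exists>Z. X \<approx> cpl a b @ Z \<and> Y \<approx> cpl b a @ Z)"

lemma lprefix_refl [simp, intro!]: "u \<preceq> u"
  unfolding lprefix_def by (intro exI[of _ "[]"]) simp

lemma lprefix_trans [trans]: "u \<preceq> v \<Longrightarrow> v \<preceq> w \<Longrightarrow> u \<preceq> w"
  unfolding lprefix_def by (metis append_assoc beq_append_right beq_trans)

lemma beq_imp_lprefix: "u \<approx> v \<Longrightarrow> u \<preceq> v"
  unfolding lprefix_def by (intro exI[of _ "[]"]) simp

lemma lprefix_beq_trans [trans]: "u \<preceq> v \<Longrightarrow> v \<approx> w \<Longrightarrow> u \<preceq> w"
  using beq_imp_lprefix lprefix_trans by blast

lemma beq_lprefix_trans [trans]: "u \<approx> v \<Longrightarrow> v \<preceq> w \<Longrightarrow> u \<preceq> w"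
  using beq_imp_lprefix lprefix_trans by blast

lemma lprefix_append [simp, intro!]: "u \<preceq> u @ x"
  unfolding lprefix_def by blast

lemma lprefix_append_left: "u \<preceq> v \<Longrightarrow> w @ u \<preceq> w @ v"
  unfolding lprefix_def using beq_append_left by fastforce

lemma lprefix_Cons: "u \<preceq> v \<Longrightarrow> a # u \<preceq> a # v"
  using lprefix_append_left[of u v "[a]"] by simp

lemma Nil_lprefix [simp, intro!]: "[] \<preceq> v"
  unfolding lprefix_def by auto

lemma lprefix_length: "u \<preceq> v \<Longrightarrow> length u \<le> length v"
  unfolding lprefix_def using beq_length by fastforce

lemma lprefix_set: "u \<preceq> v \<Longrightarrow> set u \<subseteq> set v"
  unfolding lprefix_def using beq_set by fastforce

lemma lprefix_red: "u \<preceq> v \<Longrightarrow> red v \<Longrightarrow> red u"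
  unfolding lprefix_def using red_beq red_appendD(1) by blast

lemma Cons_cpl: "m a b \<noteq> 0 \<Longrightarrow> a # cpl a b = alt_word a b (m a b)"
  unfolding cpl_def by (cases "m a b") auto

lemma cpl_braid: "m a b \<noteq> 0 \<Longrightarrow> a # cpl a b \<approx> b # cpl b a"
  using beq_braid[of a b] by (simp add: Cons_cpl m_sym)

lemma head_rel_imp_beq:
  assumes "head_rel a X b Y"
  shows "a # X \<approx> b # Y"
proof (cases "a = b \<and> X \<approx> Y")
  case True
  then show ?thesis by (simp add: beq_Cons)
next
  case False
  then obtain Z where m: "m a b \<noteq> 0" and Z: "X \<approx> cpl a b @ Z" "Y \<approx> cpl b a @ Z"
    using assms unfolding head_rel_def by blast
  have "a # X \<approx> (a # cpl a b) @ Z"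
    using beq_Cons[OF Z(1)] by simp
  also have "\<dots> \<approx> (b # cpl b a) @ Z"
    using cpl_braid[OF m] by (rule beq_append_right)
  also have "\<dots> \<approx> b # Y"
    using beq_Cons[OF beq_sym[OF Z(2)]] by simp
  finally show ?thesis .
qed

lemma bstep_head_rel:
  assumes "bstep (a # X) (b # Y)"
  shows "head_rel a X b Y"
  using assms
proof (cases rule: bstep.cases)
  case (1 s t x y)
  show ?thesis
  proof (cases x)
    case Nil
    have "alt_word s t (m s t) = s # cpl s t" "alt_word t s (m s t) = t # cpl t s"
      using 1 Cons_cpl[of s t] Cons_cpl[of t s] m_sym[of s t] by simp_all
    then have "a = s" "X = cpl s t @ y" "b = t" "Y = cpl t s @ y"
      using 1 Nil by simp_all
    then show ?thesis
      using 1 unfolding head_rel_def by blast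
  next
    case (Cons c x')
    then have "a = b" "bstep X Y"
      using 1 by (auto intro: bstep.intros)
    then show ?thesis
      unfolding head_rel_def beq_def by blast
  qed
qed

text \<open>Bounding the length allows an induction in which cancellation and joins are already
  available for words of length at most \<open>n\<close>.\<close>

definition reducible :: "nat \<Rightarrow> bool" where
  "reducible n \<longleftrightarrow> (\<forall>a b X Y. length X < n \<longrightarrow> a # X \<approx> b # Y \<longrightarrow> head_rel a X b Y)"

lemma head_rel_same: "head_rel a X a Y \<Longrightarrow> X \<approx> Y"
  unfolding head_rel_def using m_ge2 by blast

lemma reducibleD: "reducible n \<Longrightarrow> length X < n \<Longrightarrow> a # X \<approx> b # Y \<Longrightarrow> head_rel a X b Y"
  unfolding reducible_def by blast

lemma reducible_cancel:
  assumes "reducible n"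
  shows "length (w @ u) \<le> n \<Longrightarrow> w @ u \<approx> w @ v \<Longrightarrow> u \<approx> v"
proof (induction w)
  case (Cons a w)
  then have "w @ u \<approx> w @ v"
    using reducibleD[OF assms, of "w @ u" a a "w @ v"] head_rel_same by simp
  then show ?case using Cons by simp
qed simp

text \<open>
  The word \<open>w\<close> is carried along since the join of \<open>x\<close> and \<open>y\<close> has to remain reduced after
  multiplication by a generator on the left.
\<close>

lemma reduced_join:
  assumes "reducible n"
  shows "length V \<le> n \<Longrightarrow> red (w @ x) \<Longrightarrow> red (w @ y) \<Longrightarrow> x \<preceq> V \<Longrightarrow> y \<preceq> V
    \<Longrightarrow> \<exists>u. red (w @ u) \<and> u \<preceq> V \<and> x \<preceq> u \<and> y \<preceq> u"
proof (induction "length V" arbitrary: V w x y rule: less_induct)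
  case less
  \<comment> \<open>A common first letter is moved from \<open>x\<close>, \<open>y\<close> and
    \<open>V\<close> to the end of \<open>w\<close>, and the induction hypothesis applies to the
    shorter multiple.\<close>
  have same: "\<exists>u. red (w @ u) \<and> u \<preceq> V \<and> s # x' \<preceq> u \<and> s # y' \<preceq> u"
    if xy: "red (w @ s # x')" "red (w @ s # y')" "s # x' \<preceq> V" "s # y' \<preceq> V" for s x' y'
  proof -
    obtain p q where pq: "(s # x') @ p \<approx> V" "(s # y') @ q \<approx> V"
      using xy unfolding lprefix_def by blast
    have len: "length V = Suc (length (x' @ p))"
      using beq_length[OF pq(1)] by simp
    have "s # x' @ p \<approx> s # y' @ q"
      using beq_trans[OF pq(1) beq_sym[OF pq(2)]] by simp
    then have "x' @ p \<approx> y' @ q"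
      using reducibleD[OF assms, of "x' @ p" s s "y' @ q"] len less.prems(1) head_rel_same by simp
    then have "y' \<preceq> x' @ p"
      unfolding lprefix_def using beq_sym by blast
    moreover have "red ((w @ [s]) @ x')" "red ((w @ [s]) @ y')"
      using xy by simp_all
    ultimately obtain u where u: "red ((w @ [s]) @ u)" "u \<preceq> x' @ p" "x' \<preceq> u" "y' \<preceq> u"
      using less.hyps[of "x' @ p" "w @ [s]" x' y'] len less.prems(1) lprefix_append by force
    have "s # u \<preceq> V"
      using lprefix_beq_trans[OF lprefix_Cons[OF u(2)]] pq(1) by simp
    then show ?thesis
      using u lprefix_Cons by (intro exI[of _ "s # u"]) auto
  qed
  show ?case
  proof (cases x)
    case Nil
    then show ?thesis using less.prems by (intro exI[of _ y]) auto
  next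
    case x: (Cons s x')
    show ?thesis
    proof (cases y)
      case Nil
      then show ?thesis using less.prems by (intro exI[of _ x]) auto
    next
      case y: (Cons t y')
      show ?thesis
      proof (cases "s = t")
        case True
        then show ?thesis using same less.prems x y by blast
      next
        case False
        obtain p q where pq: "x @ p \<approx> V" "y @ q \<approx> V"
          using less.prems unfolding lprefix_def by blast
        have "s # x' @ p \<approx> t # y' @ q"
          using beq_trans[OF pq(1) beq_sym[OF pq(2)]] x y by simp
        moreover have "length (x' @ p) < n"
          using beq_length[OF pq(1)] x less.prems(1) by simp
        ultimately have "head_rel s (x' @ p) t (y' @ q)"
          using assms unfolding reducible_def by blast
        then obtain Z where m: "m s t \<noteq> 0" and Z: "x' @ p \<approx> cpl s t @ Z"
          using False unfolding head_rel_def by blast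
        \<comment> \<open>The braid word of \<open>s\<close> and \<open>t\<close> divides
          \<open>V\<close>. It links the two first letters: join it with \<open>x\<close> by means
          of \<open>s\<close>, rewrite the result to start with \<open>t\<close>, then join with
          \<open>y\<close>.\<close>
        define d where "d = s # cpl s t"
        have dV: "d \<preceq> V"
          unfolding lprefix_def d_def
          using beq_trans[OF beq_sym[OF beq_Cons[OF Z, of s]]] pq(1) x by auto
        have "red (w @ [s])" "red (w @ [t])"
          using less.prems red_appendD(1)[of "w @ [s]" x'] red_appendD(1)[of "w @ [t]" y'] x y
          by simp_all
        then have "red (w @ d)"
          using red_append_alt_word[OF False] m by (simp add: d_def Cons_cpl)
        then obtain u where u: "red (w @ u)" "u \<preceq> V" "x \<preceq> u" "d \<preceq> u"
          using same[of s x' "cpl s t"] less.prems x dV by (auto simp: d_def)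
        have "t # cpl t s \<preceq> u"
          using beq_lprefix_trans[OF beq_sym[OF cpl_braid[OF m]]] u(4) by (simp add: d_def)
        then obtain r where r: "t # cpl t s @ r \<approx> u"
          unfolding lprefix_def by auto
        have "red (w @ t # cpl t s @ r)"
          using red_beq[OF beq_append_left[OF r]] u(1) by blast
        moreover have "t # cpl t s @ r \<preceq> V"
          using beq_lprefix_trans[OF r u(2)] .
        ultimately obtain u' where u': "red (w @ u')" "u' \<preceq> V" "t # cpl t s @ r \<preceq> u'" "y \<preceq> u'"
          using same[of t "cpl t s @ r" y'] less.prems y by auto
        have "x \<preceq> u'"
          using lprefix_trans[OF u(3)] beq_lprefix_trans[OF beq_sym[OF r]] u'(3) by blast
        then show ?thesis using u' by blast
      qed
    qed
  qed
qed

text \<open>After reversal \<open>a\<close> and \<open>b\<close> are two descents, so the braid word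
  splits off in the Coxeter group; Matsumoto's theorem lifts this to the monoid because both words
  are reduced.\<close>

lemma red_braid_prefix:
  assumes "red u" "[a] \<preceq> u" "[b] \<preceq> u" "a \<noteq> b"
  shows "m a b \<noteq> 0 \<and> alt_word a b (m a b) \<preceq> u"
proof -
  have desc: "\<not> ascent (rev u) c" if c: "[c] \<preceq> u" for c
  proof -
    obtain x where x: "c # x \<approx> u"
      using c unfolding lprefix_def by auto
    then have "red (rev x @ [c])"
      using assms(1) red_beq red_rev[of "c # x"] by simp
    moreover have "rev u \<sim> rev x @ [c]"
      using ceq_rev[OF beq_imp_ceq[OF beq_sym[OF x]]] by simp
    ultimately show ?thesis
      using not_ascent_snoc ascent_cong by blast
  qed
  obtain v where m: "m a b \<noteq> 0" and v: "red v" "rev u \<sim> v @ alt_word a b (m a b)"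
      "wlen (rev u) = length v + m a b"
    using ex_braid_suffix[OF assms(4), of "rev u"] desc assms(2,3) by blast
  have u: "u \<sim> rev (alt_word a b (m a b)) @ rev v"
    using ceq_rev[OF v(2)] by simp
  moreover have "red (rev (alt_word a b (m a b)) @ rev v)"
    using red_ceq_length[OF assms(1) u] v(3) assms(1) unfolding red_def wlen_rev by simp
  ultimately have "u \<approx> rev (alt_word a b (m a b)) @ rev v"
    using assms(1) matsumoto by blast
  moreover have "rev (alt_word a b (m a b)) \<approx> alt_word a b (m a b)"
    using beq_sym[OF beq_braid[OF m]] by (simp add: rev_alt_word)
  ultimately have "u \<approx> alt_word a b (m a b) @ rev v"
    using beq_append_right beq_trans by blast
  then show ?thesis
    using m beq_sym unfolding lprefix_def by blast
qed

text \<open>A single step satisfies \<open>head_rel\<close>, so it is enough to prove transitivity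
  for tails of length at most \<open>n\<close> and to follow the chain of steps. The critical case
  is three distinct first letters \<open>a\<close>, \<open>c\<close>, \<open>b\<close>.\<close>

lemma reducible_Suc:
  assumes "reducible n"
  shows "reducible (Suc n)"
proof -
  have trans: "head_rel a X b Y"
    if len: "length X \<le> n" and ac: "head_rel a X c V" and cb: "head_rel c V b Y" for a b c X Y V
  proof -
    have lenV: "length V = length X" and lenY: "length Y = length X"
      using beq_length[OF head_rel_imp_beq[OF ac]] beq_length[OF head_rel_imp_beq[OF cb]] by simp_all
    consider (1) "a = c" | (2) "c = b" | (3) "a = b" "a \<noteq> c" | (4) "a \<noteq> c" "c \<noteq> b" "a \<noteq> b"
      by blast
    then show ?thesis
    proof cases
      case 1
      then have "X \<approx> V" using ac head_rel_same by blast
      then show ?thesis using 1 cb beq_trans unfolding head_rel_def by blast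
    next
      case 2
      then have "V \<approx> Y" using cb head_rel_same by blast
      then show ?thesis using 2 ac beq_trans beq_sym unfolding head_rel_def by metis
    next
      case 3
      obtain U where U: "X \<approx> cpl a c @ U" "V \<approx> cpl c a @ U"
        using ac 3 unfolding head_rel_def by blast
      obtain U' where U': "V \<approx> cpl c b @ U'" "Y \<approx> cpl b c @ U'"
        using cb 3 unfolding head_rel_def by blast
      have "cpl c a @ U \<approx> cpl c a @ U'"
        using beq_trans[OF beq_sym[OF U(2)] U'(1)] 3 by simp
      then have "U \<approx> U'"
        using reducible_cancel[OF assms] beq_length[OF U(2)] lenV len by simp
      then have "cpl a c @ U \<approx> Y"
        using beq_trans[OF beq_append_left beq_sym[OF U'(2)]] 3 by simp
      then have "X \<approx> Y"
        using U(1) beq_trans by blast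
      then show ?thesis using 3 unfolding head_rel_def by blast
    next
      case 4
      obtain U where ma: "m a c \<noteq> 0" and U: "X \<approx> cpl a c @ U" "V \<approx> cpl c a @ U"
        using ac 4 unfolding head_rel_def by blast
      obtain U' where mb: "m c b \<noteq> 0" and U': "V \<approx> cpl c b @ U'" "Y \<approx> cpl b c @ U'"
        using cb 4 unfolding head_rel_def by blast
      have single: "red ([] @ [s])" for s
        using wlen_snoc[of "[]" s] red_Nil unfolding red_def by simp
      have "red ([c] @ cpl c d)" if "m c d \<noteq> 0" for d
        using red_append_alt_word[OF _ single[of c] single[of d]] that m_ge2[OF that]
        by (simp add: Cons_cpl)
      then have "red ([c] @ cpl c a)" "red ([c] @ cpl c b)"
        using ma mb m_sym by auto
      moreover have "cpl c a \<preceq> V" "cpl c b \<preceq> V"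
        using U(2) U'(1) beq_sym unfolding lprefix_def by blast+
      \<comment> \<open>The join is taken with \<open>w = [c]\<close>, so that \<open>c # u\<close>
        is reduced. It is divisible by \<open>a\<close> and \<open>b\<close>, and the Coxeter group
        then supplies the relation between them.\<close>
      ultimately obtain u where u: "red ([c] @ u)" "u \<preceq> V" "cpl c a \<preceq> u" "cpl c b \<preceq> u"
        using reduced_join[OF assms] len lenV by metis
      obtain p q Z where p: "cpl c a @ p \<approx> u" and q: "cpl c b @ q \<approx> u" and Z: "u @ Z \<approx> V"
        using u unfolding lprefix_def by blast
      have cu: "d # cpl d c @ r \<approx> c # u" if "m c d \<noteq> 0" "cpl c d @ r \<approx> u" for d r
      proof -
        have "(d # cpl d c) @ r \<approx> (c # cpl c d) @ r"
          using cpl_braid[OF that(1)] beq_sym by (intro beq_append_right) blast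
        also have "(c # cpl c d) @ r \<approx> c # u"
          using beq_Cons[OF that(2), of c] by simp
        finally show ?thesis by simp
      qed
      have cua: "a # cpl a c @ p \<approx> c # u"
        using cu[OF _ p] ma m_sym by simp
      have cub: "b # cpl b c @ q \<approx> c # u"
        using cu[OF mb q] .
      have red_cu: "red (c # u)" using u(1) by simp
      have ab: "[a] \<preceq> c # u" "[b] \<preceq> c # u"
        using cua cub unfolding lprefix_def by auto
      then obtain r where mab: "m a b \<noteq> 0" and r: "alt_word a b (m a b) @ r \<approx> c # u"
        using red_braid_prefix[OF red_cu ab \<open>a \<noteq> b\<close>] unfolding lprefix_def by blast
      have ra: "a # cpl a b @ r \<approx> c # u"
        using r Cons_cpl[OF mab] by (metis append_Cons)
      have rb: "b # cpl b a @ r \<approx> c # u"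
      proof -
        have "(b # cpl b a) @ r \<approx> (a # cpl a b) @ r"
          using cpl_braid[OF mab] beq_sym by (intro beq_append_right) blast
        then show ?thesis using ra beq_trans by simp
      qed
      \<comment> \<open>These tails may have length \<open>n\<close>, which
        \<open>reducible n\<close> does not cover. For reduced words cancellation comes from the
        group and Matsumoto's theorem instead.\<close>
      have strip: "y \<approx> z" if "s # y \<approx> c # u" "s # z \<approx> c # u" for s y z
      proof -
        have "[s] @ y \<sim> [s] @ z"
          using beq_imp_ceq[OF beq_trans[OF that(1) beq_sym[OF that(2)]]] by simp
        then have "y \<sim> z" by (rule ceq_append_cancel_left)
        moreover have "red (s # y)" "red (s # z)"
          using red_beq[OF that(1)] red_beq[OF that(2)] red_cu by simp_all
        then have "red y" "red z"
          using red_appendD(2)[of "[s]" y] red_appendD(2)[of "[s]" z] by simp_all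
        ultimately show ?thesis by (intro matsumoto)
      qed
      have head: "W \<approx> cpl d e @ r @ Z"
        if "W \<approx> cpl d c @ T" "V \<approx> cpl c d @ T" "cpl c d @ x \<approx> u"
          "d # cpl d c @ x \<approx> c # u" "d # cpl d e @ r \<approx> c # u" for d e W T x
      proof -
        have "cpl c d @ T \<approx> cpl c d @ x @ Z"
          using beq_trans[OF beq_sym[OF that(2)]]
            beq_trans[OF beq_sym[OF Z] beq_append_right[OF beq_sym[OF that(3)]]] by simp
        then have "T \<approx> x @ Z"
          using reducible_cancel[OF assms] beq_length[OF that(2)] lenV len by simp
        then have "W \<approx> (cpl d c @ x) @ Z"
          using beq_trans[OF that(1) beq_append_left] by simp
        also have "(cpl d c @ x) @ Z \<approx> (cpl d e @ r) @ Z"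
          using strip[OF that(4,5)] by (rule beq_append_right)
        finally show ?thesis by simp
      qed
      have "X \<approx> cpl a b @ r @ Z" "Y \<approx> cpl b a @ r @ Z"
        using head[OF U p cua ra] head[OF U'(2,1) q cub rb] .
      then show ?thesis using mab unfolding head_rel_def by blast
    qed
  qed
  have "\<forall>b Y. w = b # Y \<longrightarrow> head_rel a X b Y" if "length X \<le> n" "a # X \<approx> w" for a X w
    using that(2) unfolding beq_def
  proof (induction rule: rtranclp_induct)
    case base
    then show ?case by (simp add: head_rel_def)
  next
    case (step v w)
    have "length v = length (a # X)"
      using step.hyps(1) beq_length unfolding beq_def by fastforce
    then obtain c V where v: "v = c # V" by (cases v) auto
    have "head_rel a X c V" using step.IH v by blast
    then show ?case
      using step.hyps(2) trans[OF that(1)] bstep_head_rel[of c V] v by blast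
  qed
  then show ?thesis unfolding reducible_def by auto
qed

lemma reducible: "reducible n"
  by (induction n) (auto simp: reducible_def[of 0] intro: reducible_Suc)

theorem beq_Cons_head_rel: "a # X \<approx> b # Y \<Longrightarrow> head_rel a X b Y"
  using reducibleD[OF reducible[of "Suc (length X)"]] by simp

lemma beq_append_cancel_left: "w @ u \<approx> w @ v \<Longrightarrow> u \<approx> v"
  using reducible_cancel[OF reducible] by blast

lemma beq_append_cancel_right: "u @ w \<approx> v @ w \<Longrightarrow> u \<approx> v"
  using beq_append_cancel_left[of "rev w" "rev u" "rev v"] beq_rev[of "u @ w" "v @ w"]
  by (simp add: beq_rev_iff)

lemma Cons_lprefix_cancel: "a # u \<preceq> a # v \<longleftrightarrow> u \<preceq> v"
  using beq_append_cancel_left[of "[a]"] lprefix_Cons unfolding lprefix_def by fastforce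

lemma append_lprefix_cancel: "w @ u \<preceq> w @ v \<longleftrightarrow> u \<preceq> v"
  using beq_append_cancel_left[of w] lprefix_append_left[of u v w] unfolding lprefix_def by auto


section \<open>Least common multiples\<close>

definition is_lcm :: "'a list set \<Rightarrow> 'a list \<Rightarrow> bool" where
  "is_lcm A l \<longleftrightarrow> (\<forall>a\<in>A. a \<preceq> l) \<and> (\<forall>w. (\<forall>a\<in>A. a \<preceq> w) \<longrightarrow> l \<preceq> w)"

definition common_multiple :: "'a list set \<Rightarrow> bool" where
  "common_multiple A \<longleftrightarrow> (\<exists>w. \<forall>a\<in>A. a \<preceq> w)"

lemma Cons_lprefixE:
  assumes "s # u \<preceq> w"
  obtains v where "w \<approx> s # v" "u \<preceq> v"
  using assms unfolding lprefix_def by (metis append_Cons beq_refl beq_sym)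

lemma singleton_lprefixE:
  assumes "[s] \<preceq> w"
  obtains v where "w \<approx> s # v"
  using assms Cons_lprefixE by blast

lemma singleton_lprefix_Cons: "[s] \<preceq> s # w"
  using lprefix_append[of "[s]" w] by simp

lemma braid_lprefix:
  assumes "[s] \<preceq> w" "[t] \<preceq> w" "s \<noteq> t"
  shows "m s t \<noteq> 0" "s # cpl s t \<preceq> w"
proof -
  obtain x y where x: "w \<approx> s # x" and y: "w \<approx> t # y"
    using assms singleton_lprefixE by metis
  then have "head_rel s x t y"
    using beq_Cons_head_rel beq_sym beq_trans by blast
  then obtain Z where m: "m s t \<noteq> 0" and Z: "x \<approx> cpl s t @ Z"
    using assms(3) unfolding head_rel_def by blast
  show "m s t \<noteq> 0" by (rule m)
  have "(s # cpl s t) @ Z \<approx> w"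
    using beq_trans[OF x beq_Cons[OF Z]] beq_sym by simp
  then show "s # cpl s t \<preceq> w"
    unfolding lprefix_def by blast
qed

lemma is_lcm_Cons:
  assumes "is_lcm {u, v} l"
  shows "is_lcm {s # u, s # v} (s # l)"
  unfolding is_lcm_def
proof (intro conjI allI impI)
  show "\<forall>a\<in>{s # u, s # v}. a \<preceq> s # l"
    using assms lprefix_Cons unfolding is_lcm_def by blast
  fix w assume *: "\<forall>a\<in>{s # u, s # v}. a \<preceq> w"
  then obtain x where x: "w \<approx> s # x" "u \<preceq> x"
    using Cons_lprefixE by blast
  have "s # v \<preceq> s # x"
    using * lprefix_beq_trans x(1) by blast
  then have "l \<preceq> x"
    using assms x(2) Cons_lprefix_cancel unfolding is_lcm_def by blast
  then show "s # l \<preceq> w"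
    using lprefix_beq_trans[OF lprefix_Cons beq_sym[OF x(1)]] by blast
qed

lemma is_lcm_beq:
  assumes "is_lcm A l" "l \<approx> l'"
  shows "is_lcm A l'"
  using assms lprefix_beq_trans beq_lprefix_trans[OF beq_sym] unfolding is_lcm_def by metis

lemma is_lcm_insert:
  assumes "is_lcm A l" "is_lcm {a, l} l'"
  shows "is_lcm (insert a A) l'"
  using assms lprefix_trans unfolding is_lcm_def by (metis insertCI insertE singletonD)

lemma cpl_subset: "set (cpl s t) \<subseteq> {s, t}"
  unfolding cpl_def using set_alt_word_subset[of t s] by blast

text \<open>For distinct first letters \<open>s\<close> and \<open>t\<close> every common multiple
  is also divisible by their braid word, so the lcm arises by joining \<open>u\<close> with the
  braid word and the result with \<open>v\<close>, each time along a common first letter. No letters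
  other than those of \<open>u\<close> and \<open>v\<close> enter.\<close>

lemma ex_lcm_pair:
  "u \<preceq> w \<Longrightarrow> v \<preceq> w \<Longrightarrow> \<exists>l. is_lcm {u, v} l \<and> set l \<subseteq> set u \<union> set v"
proof (induction "length w" arbitrary: u v w rule: less_induct)
  case less
  have same: "\<exists>l. is_lcm {s # x, s # y} (s # l) \<and> set l \<subseteq> set x \<union> set y"
    if xy: "s # x \<preceq> w" "s # y \<preceq> w" for s x y
  proof -
    obtain w' where w': "w \<approx> s # w'" "x \<preceq> w'"
      using xy(1) Cons_lprefixE by blast
    have "y \<preceq> w'"
      using lprefix_beq_trans[OF xy(2) w'(1)] Cons_lprefix_cancel by blast
    then obtain l where "is_lcm {x, y} l" "set l \<subseteq> set x \<union> set y"
      using less.hyps[of w' x y] w' beq_length[OF w'(1)] by auto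
    then show ?thesis
      using is_lcm_Cons by blast
  qed
  consider (1) "u = []" | (2) "v = []" | (3) s u' t v' where "u = s # u'" "v = t # v'"
    by (cases u; cases v) auto
  then show ?case
  proof cases
    case 1
    then show ?thesis by (intro exI[of _ v]) (auto simp: is_lcm_def)
  next
    case 2
    then show ?thesis by (intro exI[of _ u]) (auto simp: is_lcm_def)
  next
    case 3
    show ?thesis
    proof (cases "s = t")
      case True
      then obtain l where "is_lcm {u, v} (s # l)" "set l \<subseteq> set u' \<union> set v'"
        using same[of s u' v'] less.prems 3 by auto
      then show ?thesis
        using 3 by (intro exI[of _ "s # l"]) auto
    next
      case False
      have st: "[s] \<preceq> x \<and> [t] \<preceq> x" if "u \<preceq> x" "v \<preceq> x" for x
        using that singleton_lprefix_Cons lprefix_trans 3 by blast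
      have m: "m s t \<noteq> 0" and dw: "s # cpl s t \<preceq> w"
        using braid_lprefix False st less.prems by blast+
      obtain l1 where l1: "is_lcm {u, s # cpl s t} (s # l1)" "set l1 \<subseteq> set u' \<union> set (cpl s t)"
        using same[of s u' "cpl s t"] less.prems(1) dw 3 by auto
      have "t # cpl t s \<preceq> s # l1"
        using l1(1) beq_lprefix_trans[OF beq_sym[OF cpl_braid[OF m]]] unfolding is_lcm_def by blast
      then obtain l1' where l1': "s # l1 \<approx> t # l1'"
        using Cons_lprefixE by blast
      have lcm1: "is_lcm {u, s # cpl s t} (t # l1')"
        using is_lcm_beq l1(1) l1' by blast
      have "t # l1' \<preceq> w"
        using lcm1 less.prems(1) dw unfolding is_lcm_def by blast
      then obtain l2 where l2: "is_lcm {t # l1', v} (t # l2)" "set l2 \<subseteq> set l1' \<union> set v'"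
        using same[of t l1' v'] less.prems(2) 3 by auto
      have "is_lcm {u, v} (t # l2)"
        unfolding is_lcm_def
      proof (intro conjI allI impI)
        show "\<forall>a\<in>{u, v}. a \<preceq> t # l2"
          using lcm1 l2(1) lprefix_trans unfolding is_lcm_def by blast
        fix x assume x: "\<forall>a\<in>{u, v}. a \<preceq> x"
        then have "s # cpl s t \<preceq> x"
          using braid_lprefix(2) st False by blast
        then have "t # l1' \<preceq> x"
          using lcm1 x unfolding is_lcm_def by blast
        then show "t # l2 \<preceq> x"
          using l2(1) x unfolding is_lcm_def by blast
      qed
      moreover have "set (t # l2) \<subseteq> set u \<union> set v"
        using l1(2) l2(2) cpl_subset[of s t] beq_set[OF l1'] 3 by auto
      ultimately show ?thesis by blast
    qed
  qed
qed

lemma ex_lcm: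
  assumes "finite A" "common_multiple A"
  shows "\<exists>l. is_lcm A l \<and> set l \<subseteq> \<Union> (set ` A)"
proof -
  obtain w where "\<forall>a\<in>A. a \<preceq> w"
    using assms(2) unfolding common_multiple_def by blast
  with assms(1) show ?thesis
  proof (induction rule: finite_induct)
    case empty
    then show ?case by (intro exI[of _ "[]"]) (simp add: is_lcm_def)
  next
    case (insert a A)
    then obtain l where l: "is_lcm A l" "set l \<subseteq> \<Union> (set ` A)" by auto
    then have "a \<preceq> w" "l \<preceq> w"
      using insert.prems unfolding is_lcm_def by auto
    then obtain l' where "is_lcm {a, l} l'" "set l' \<subseteq> set a \<union> set l"
      using ex_lcm_pair by blast
    then show ?case
      using is_lcm_insert l by (intro exI[of _ l']) auto
  qed
qed

text \<open>Equivalently, \<open>v @ c\<close> is an lcm of \<open>u\<close> and \<open>v\<close>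
  without new letters. This form turns divisibility of words starting with \<open>v\<close> into
  divisibility of their remainders.\<close>

definition is_complement :: "'a list \<Rightarrow> 'a list \<Rightarrow> 'a list \<Rightarrow> bool" where
  "is_complement u v c \<longleftrightarrow> set c \<subseteq> set u \<union> set v \<and> (\<forall>x. u \<preceq> v @ x \<longleftrightarrow> c \<preceq> x)"

lemma ex_complement:
  assumes "common_multiple {u, v}"
  shows "\<exists>c. is_complement u v c"
proof -
  obtain l where l: "is_lcm {u, v} l" "set l \<subseteq> set u \<union> set v"
    using ex_lcm[OF _ assms] by auto
  then have "v \<preceq> l" by (simp add: is_lcm_def)
  then obtain c where c: "v @ c \<approx> l" unfolding lprefix_def by blast
  have "u \<preceq> v @ x \<longleftrightarrow> c \<preceq> x" for x
  proof
    assume "u \<preceq> v @ x"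
    then have "l \<preceq> v @ x" using l(1) by (simp add: is_lcm_def)
    then show "c \<preceq> x"
      using beq_lprefix_trans[OF c] append_lprefix_cancel by blast
  next
    assume "c \<preceq> x"
    then have "l \<preceq> v @ x"
      using beq_lprefix_trans[OF beq_sym[OF c]] append_lprefix_cancel by blast
    moreover have "u \<preceq> l" using l(1) by (simp add: is_lcm_def)
    ultimately show "u \<preceq> v @ x" using lprefix_trans by blast
  qed
  moreover have "set c \<subseteq> set u \<union> set v"
    using l(2) beq_set[OF c] by auto
  ultimately show ?thesis unfolding is_complement_def by blast
qed

section \<open>Supports of elements with a common multiple\<close>

lemma common_multiple_subset: "common_multiple B \<Longrightarrow> A \<subseteq> B \<Longrightarrow> common_multiple A"
  unfolding common_multiple_def by blast

text \<open>
  By induction on a common multiple \<open>w\<close>: a first letter of \<open>x\<close> other than \<open>t\<close> can be cancelled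
  from \<open>x\<close> and \<open>w\<close> if \<open>y\<close> is replaced by its complement.
\<close>

lemma related_generators:
  "x \<preceq> w \<Longrightarrow> y \<preceq> w \<Longrightarrow> t \<in> set x \<Longrightarrow> u \<notin> set x \<Longrightarrow> u \<in> set y \<Longrightarrow> t \<notin> set y \<Longrightarrow> m t u \<noteq> 0"
proof (induction "length w" arbitrary: x y w t u rule: less_induct)
  case less
  have *: "m t u \<noteq> 0"
    if xy: "s # x' \<preceq> w" "y \<preceq> w" "t \<in> set (s # x')" "u \<notin> set (s # x')" "u \<in> set y" "t \<notin> set y"
      "s \<noteq> t" for s x' y t u
  proof -
    obtain w' where w': "w \<approx> s # w'" "x' \<preceq> w'"
      using xy(1) Cons_lprefixE by blast
    have "common_multiple {y, [s]}"
      using xy(1,2) lprefix_trans[OF singleton_lprefix_Cons] unfolding common_multiple_def by blast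
    then obtain c where c: "set c \<subseteq> set y \<union> set [s]" "\<And>z. y \<preceq> [s] @ z \<longleftrightarrow> c \<preceq> z"
      using ex_complement unfolding is_complement_def by blast
    have "c \<preceq> w'"
      using c(2)[of w'] lprefix_beq_trans[OF xy(2) w'(1)] by simp
    \<comment> \<open>As \<open>y\<close> divides \<open>s # c\<close>, passing from
      \<open>y\<close> to \<open>c\<close> loses at most the letter \<open>s\<close>; so
      \<open>u\<close> still occurs in \<open>c\<close>, while \<open>t\<close> does not.\<close>
    moreover have "set y \<subseteq> insert s (set c)"
      using c(2)[of c] lprefix_set[of y "s # c"] by simp
    ultimately show ?thesis
      using less.hyps[of w' x' c t u] w' beq_length[OF w'(1)] c(1) xy by auto
  qed
  obtain s x' r y' where xy: "x = s # x'" "y = r # y'"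
    using less.prems by (cases x; cases y) auto
  show ?case
  proof (cases "s = t \<and> r = u")
    case True
    then show ?thesis
      using braid_lprefix(1)[of t w u] lprefix_trans[OF singleton_lprefix_Cons] less.prems xy
      by (metis list.set_intros(1))
  next
    case False
    then show ?thesis
      using *[of s x' y t u] *[of r y' x u t] less.prems xy m_sym[of t u] by auto
  qed
qed

section \<open>Parabolic submonoids with a common multiple of the generators\<close>

abbreviation letters :: "'a set \<Rightarrow> 'a list set" where
  "letters I \<equiv> (\<lambda>s. [s]) ` I"

abbreviation pow :: "'a list \<Rightarrow> nat \<Rightarrow> 'a list" where
  "pow u k \<equiv> concat (replicate k u)"

lemma pow_Suc_right: "pow u (Suc k) = pow u k @ u"
  by (induction k) auto

context
  fixes I :: "'a set" and D :: "'a list"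
  assumes finI: "finite I" and D_lcm: "is_lcm (letters I) D" and D_set: "set D \<subseteq> I"
begin

lemma lprefix_Delta: "s \<in> I \<Longrightarrow> [s] \<preceq> D"
  using D_lcm unfolding is_lcm_def by blast

text \<open>For \<open>t\<close> other than \<open>s\<close> the braid word starting with
  \<open>t\<close> divides \<open>D\<close>, hence so does \<open>cpl s t\<close>, its prefix one
  letter shorter. Thus the braid word of \<open>s\<close> and \<open>t\<close>, and with it
  \<open>t\<close>, divides \<open>s # D\<close>.\<close>

lemma Delta_lprefix_Cons:
  assumes "s \<in> I"
  shows "D \<preceq> s # D"
proof -
  have "[t] \<preceq> s # D" if "t \<in> I" for t
  proof (cases "s = t")
    case True
    then show ?thesis using singleton_lprefix_Cons by blast
  next
    case False
    have m: "m t s \<noteq> 0" and d: "t # cpl t s \<preceq> D"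
      using braid_lprefix[of t D s] lprefix_Delta assms that False by blast+
    obtain n where n: "m t s = Suc n" using m not0_implies_Suc by blast
    have "cpl s t \<preceq> t # cpl t s"
      using lprefix_append[of "alt_word t s n"] m
      by (simp add: Cons_cpl) (simp add: cpl_def m_sym[of s t] n alt_word_Suc del: alt_word.simps)
    then have "s # cpl s t \<preceq> s # D"
      using d lprefix_trans lprefix_Cons by blast
    moreover have "t # cpl t s \<approx> s # cpl s t"
      using cpl_braid[OF m] .
    ultimately show ?thesis
      using singleton_lprefix_Cons beq_lprefix_trans lprefix_trans by blast
  qed
  then show ?thesis using D_lcm unfolding is_lcm_def by blast
qed

lemma Delta_conj: "s \<in> I \<Longrightarrow> \<exists>s'\<in>I. s # D \<approx> D @ [s']"
proof -
  assume s: "s \<in> I"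
  obtain x where x: "D @ x \<approx> s # D"
    using Delta_lprefix_Cons[OF s] unfolding lprefix_def by blast
  have "length x = 1" using beq_length[OF x] by simp
  then obtain s' where s': "x = [s']" by (cases x) auto
  moreover have "s' \<in> I"
    using beq_set[OF x] s D_set s' by auto
  ultimately show ?thesis
    using x beq_sym by blast
qed

text \<open>Conjugation by \<open>D\<close> is injective on \<open>I\<close> by right cancellation,
  and \<open>I\<close> is finite.\<close>

lemma Delta_conj_surj:
  assumes "s' \<in> I"
  shows "\<exists>s\<in>I. s # D \<approx> D @ [s']"
proof -
  obtain f where f: "\<And>s. s \<in> I \<Longrightarrow> f s \<in> I \<and> s # D \<approx> D @ [f s]"
    using Delta_conj by metis
  have "inj_on f I"
  proof (rule inj_onI)
    fix s t assume "s \<in> I" "t \<in> I" "f s = f t"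
    then have "s # D \<approx> t # D"
      using f beq_sym beq_trans by metis
    then show "s = t"
      using beq_append_cancel_right[of "[s]" D "[t]"] beq_set[of "[s]" "[t]"] by simp
  qed
  then have "f ` I = I"
    using finI f by (intro endo_inj_surj) auto
  then show ?thesis using assms f by force
qed

lemma Delta_pow_conj: "s \<in> I \<Longrightarrow> \<exists>s'\<in>I. s # pow D k \<approx> pow D k @ [s']"
proof (induction k arbitrary: s)
  case (Suc k)
  obtain r where r: "r \<in> I" "s # D \<approx> D @ [r]" using Delta_conj Suc.prems by blast
  obtain s' where s': "s' \<in> I" "r # pow D k \<approx> pow D k @ [s']" using Suc.IH r(1) by blast
  have "s # pow D (Suc k) \<approx> D @ r # pow D k"
    using beq_append_right[OF r(2), of "pow D k"] by simp
  also have "\<dots> \<approx> pow D (Suc k) @ [s']"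
    using beq_append_left[OF s'(2), of D] by simp
  finally show ?case using s'(1) by blast
qed auto

text \<open>The first letter is moved through the power of \<open>D\<close> and absorbed into one
  more factor \<open>D\<close>.\<close>

lemma lprefix_Delta_pow: "set x \<subseteq> I \<Longrightarrow> length x \<le> k \<Longrightarrow> x \<preceq> pow D k"
proof (induction x arbitrary: k)
  case (Cons s x)
  then obtain j where j: "k = Suc j" "length x \<le> j" by (cases k) auto
  then obtain s' where s': "s' \<in> I" "s # pow D j \<approx> pow D j @ [s']"
    using Delta_pow_conj[of s j] Cons.prems by auto
  have "s # x \<preceq> s # pow D j"
    using Cons j by (intro lprefix_Cons) auto
  also have "\<dots> \<approx> pow D j @ [s']" by (rule s'(2))
  also have "\<dots> \<preceq> pow D j @ D"
    using lprefix_Delta[OF s'(1)] by (rule lprefix_append_left)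
  finally show ?case by (simp add: j pow_Suc_right del: replicate.simps)
qed auto

text \<open>Successive joins give a reduced divisor of \<open>D\<close> that is a common multiple of
  the generators; \<open>D\<close> divides it in turn.\<close>

lemma red_Delta: "red D"
proof -
  have "\<exists>u. red u \<and> u \<preceq> D \<and> (\<forall>s\<in>J. [s] \<preceq> u)" if "J \<subseteq> I" for J
    using finite_subset[OF that finI] that
  proof (induction rule: finite_induct)
    case empty
    then show ?case by (intro exI[of _ "[]"]) simp
  next
    case (insert s J)
    then obtain u where u: "red u" "u \<preceq> D" "\<forall>s\<in>J. [s] \<preceq> u" by blast
    have "red [s]" using wlen_snoc[of "[]" s] red_Nil unfolding red_def by simp
    then obtain u' where "red u'" "u' \<preceq> D" "u \<preceq> u'" "[s] \<preceq> u'"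
      using reduced_join[OF reducible, of D "length D" "[]" u "[s]"] u lprefix_Delta insert.prems
      by auto
    then show ?case using u lprefix_trans by blast
  qed
  then obtain u where "red u" "\<forall>s\<in>I. [s] \<preceq> u" by blast
  then have "D \<preceq> u" using D_lcm unfolding is_lcm_def by blast
  then show ?thesis using \<open>red u\<close> lprefix_red by blast
qed

text \<open>\<open>x\<close> and \<open>D\<close> have a reduced join. If it were \<open>D\<close>
  followed by a letter \<open>s\<close>, then \<open>D @ [s]\<close> would equal
  \<open>r # D\<close> with \<open>r\<close> dividing \<open>D\<close>, hence begin with a
  square.\<close>

lemma red_length_le_Delta:
  assumes "red x" "set x \<subseteq> I"
  shows "length x \<le> length D"
proof -
  \<comment> \<open>The extra factor ensures that \<open>D\<close> divides \<open>V\<close> even if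
    \<open>x\<close> is empty.\<close>
  define V where "V = pow D (Suc (length x))"
  have "x \<preceq> V" "D \<preceq> V"
    using lprefix_Delta_pow[OF assms(2), of "Suc (length x)"] by (simp_all add: V_def)
  then obtain u where u: "red u" "u \<preceq> V" "x \<preceq> u" "D \<preceq> u"
    using reduced_join[OF reducible, of V "length V" "[]" x D] assms(1) red_Delta by auto
  obtain v where v: "D @ v \<approx> u" using u(4) unfolding lprefix_def by blast
  have "v = []"
  proof (rule ccontr)
    assume "v \<noteq> []"
    then obtain s v' where s: "v = s # v'" by (cases v) auto
    have "set u \<subseteq> I"
      using lprefix_set[OF u(2)] D_set by (auto simp: V_def set_replicate_conv_if split: if_splits)
    then have "s \<in> I"
      using beq_set[OF v] s by auto
    then obtain r where r: "r \<in> I" "r # D \<approx> D @ [s]"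
      using Delta_conj_surj by blast
    obtain z where z: "D \<approx> r # z"
      using lprefix_Delta[OF r(1)] singleton_lprefixE by blast
    have "D @ [s] \<approx> r # r # z"
      using beq_trans[OF beq_sym[OF r(2)] beq_Cons[OF z]] .
    moreover have "red (D @ [s])"
      using red_beq[OF v] u(1) s red_appendD(1)[of "D @ [s]" v'] by simp
    ultimately have "red (r # r # z)"
      using red_beq by blast
    then show False
      using wlen_le[OF ceq_square[of "[]" r z]] unfolding red_def by simp
  qed
  then show ?thesis
    using beq_length[OF v] lprefix_length[OF u(3)] by simp
qed

end

lemma common_multiple_lists:
  assumes "finite I" "common_multiple (letters I)" "finite A" "\<forall>a\<in>A. set a \<subseteq> I"
  shows "common_multiple A"
proof -
  obtain D where D: "is_lcm (letters I) D" "set D \<subseteq> I"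
    using ex_lcm[OF _ assms(2)] assms(1) by auto
  have "a \<preceq> pow D (Max (length ` A))" if "a \<in> A" for a
    using that assms by (intro lprefix_Delta_pow[OF assms(1) D]) auto
  then show ?thesis unfolding common_multiple_def by blast
qed

section \<open>The 3-Ore condition for words\<close>

definition ore3 :: "'a list \<Rightarrow> 'a list \<Rightarrow> 'a list \<Rightarrow> bool" where
  "ore3 a b c \<longleftrightarrow> (common_multiple {a, b} \<longrightarrow> common_multiple {b, c} \<longrightarrow> common_multiple {a, c}
     \<longrightarrow> common_multiple {a, b, c})"

definition clique :: "'a set \<Rightarrow> bool" where
  "clique I \<longleftrightarrow> (\<forall>s\<in>I. \<forall>t\<in>I. s \<noteq> t \<longrightarrow> m s t \<noteq> 0)"

lemma ore3_rotate: "ore3 a b c \<Longrightarrow> ore3 b c a"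
  unfolding ore3_def by (simp add: insert_commute)

lemma common_multiple_complement:
  assumes "is_complement a u a'" "is_complement b u b'"
  shows "common_multiple {a, b, u} \<longleftrightarrow> common_multiple {a', b'}"
proof
  assume "common_multiple {a, b, u}"
  then obtain w where w: "a \<preceq> w" "b \<preceq> w" "u \<preceq> w"
    unfolding common_multiple_def by blast
  then obtain x where "u @ x \<approx> w" unfolding lprefix_def by blast
  then have "a \<preceq> u @ x" "b \<preceq> u @ x"
    using w beq_sym lprefix_beq_trans by blast+
  then show "common_multiple {a', b'}"
    using assms unfolding is_complement_def common_multiple_def by blast
next
  assume "common_multiple {a', b'}"
  then obtain x where "a' \<preceq> x" "b' \<preceq> x"
    unfolding common_multiple_def by blast
  then have "a \<preceq> u @ x" "b \<preceq> u @ x" "u \<preceq> u @ x"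
    using assms unfolding is_complement_def by blast+
  then show "common_multiple {a, b, u}"
    unfolding common_multiple_def by blast
qed

lemma is_complement_append: "is_complement (u @ v) u v"
  unfolding is_complement_def by (auto simp: append_lprefix_cancel)

text \<open>A common multiple of \<open>a\<close>, \<open>b\<close> and \<open>u @ v\<close> is
  \<open>u\<close> times one of the complements and \<open>v\<close>. The second hypothesis mentions
  common multiples so that supports of the complements can be controlled.\<close>

lemma ore3_append:
  assumes "ore3 a b u"
    and "\<And>a' b'. common_multiple {a, u} \<Longrightarrow> common_multiple {b, u}
      \<Longrightarrow> is_complement a u a' \<Longrightarrow> is_complement b u b' \<Longrightarrow> ore3 a' b' v"
  shows "ore3 a b (u @ v)"
  unfolding ore3_def
proof (intro impI)
  assume ab: "common_multiple {a, b}" and bv: "common_multiple {b, u @ v}"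
    and av: "common_multiple {a, u @ v}"
  have u: "common_multiple {c, u @ v, u}" if "common_multiple {c, u @ v}" for c
    using that lprefix_trans[OF lprefix_append[of u v]] unfolding common_multiple_def by blast
  have cu: "common_multiple {a, u}" "common_multiple {b, u}"
    using common_multiple_subset[OF u[OF av], of "{a, u}"]
      common_multiple_subset[OF u[OF bv], of "{b, u}"] by simp_all
  then obtain a' b' where c: "is_complement a u a'" "is_complement b u b'"
    using ex_complement by blast
  have "common_multiple {a, b, u}"
    using assms(1) ab cu unfolding ore3_def by blast
  then have "common_multiple {a', b'}"
    using common_multiple_complement[OF c] by simp
  moreover have "common_multiple {b', v}" "common_multiple {a', v}"
    using u[OF av] u[OF bv] common_multiple_complement[OF c(1) is_complement_append]
      common_multiple_complement[OF c(2) is_complement_append] by simp_all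
  ultimately have "common_multiple {a', b', v}"
    using assms(2)[OF cu c] unfolding ore3_def by blast
  then obtain x where "a' \<preceq> x" "b' \<preceq> x" "v \<preceq> x"
    unfolding common_multiple_def by blast
  then have "a \<preceq> u @ x" "b \<preceq> u @ x" "u @ v \<preceq> u @ x"
    using c lprefix_append_left unfolding is_complement_def by blast+
  then show "common_multiple {a, b, u @ v}"
    unfolding common_multiple_def by blast
qed

text \<open>Two letters within one support are related by assumption; otherwise one occurs only in
  \<open>x\<close>, the other only in \<open>y\<close>, and \<open>related_generators\<close>
  applies.\<close>

lemma clique_Un:
  assumes "common_multiple {x, y}" "clique (set x)" "clique (set y)"
  shows "clique (set x \<union> set y)"
proof -
  obtain w where "x \<preceq> w" "y \<preceq> w"
    using assms(1) unfolding common_multiple_def by blast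
  then have "m t u \<noteq> 0" if "t \<in> set x" "u \<in> set y" "t \<noteq> u" for t u
    using related_generators[of x w y t u] assms(2,3) that unfolding clique_def by blast
  then show ?thesis
    using assms(2,3) m_sym unfolding clique_def by (metis UnE)
qed

lemma clique_subset: "clique I \<Longrightarrow> J \<subseteq> I \<Longrightarrow> clique J"
  unfolding clique_def by blast

lemma clique_singleton [simp]: "clique {s}"
  unfolding clique_def by simp

text \<open>
  The words whose support is a clique are closed under complements and contain the generators.
  For such words the claim holds by assumption; it then extends to arbitrary words in one argument
  after the other.
\<close>

theorem ore3_of_cliques:
  assumes "finite S" "\<And>I. I \<subseteq> S \<Longrightarrow> clique I \<Longrightarrow> common_multiple (letters I)"
    and "set a \<subseteq> S" "set b \<subseteq> S" "set c \<subseteq> S"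
  shows "ore3 a b c"
proof -
  have complement_clique: "clique (set x')"
    if "common_multiple {x, [s]}" "is_complement x [s] x'" "clique (set x)" for x s x'
  proof -
    have "clique (set x \<union> set [s])"
      using that by (intro clique_Un) auto
    then show ?thesis
      using that(2) clique_subset unfolding is_complement_def by blast
  qed
  have base: "ore3 x y z"
    if clq: "clique (set x)" "clique (set y)" "clique (set z)"
      and S: "set x \<subseteq> S" "set y \<subseteq> S" "set z \<subseteq> S" for x y z
    unfolding ore3_def
  proof (intro impI)
    assume "common_multiple {x, y}" "common_multiple {y, z}" "common_multiple {x, z}"
    then have "clique (set x \<union> set y)" "clique (set y \<union> set z)" "clique (set x \<union> set z)"
      using clq clique_Un by blast+
    then have "clique (set x \<union> set y \<union> set z)"
      unfolding clique_def by blast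
    then have "common_multiple (letters (set x \<union> set y \<union> set z))"
      using S by (intro assms(2)) simp_all
    then show "common_multiple {x, y, z}"
      by (rule common_multiple_lists[rotated]) auto
  qed
  have one: "ore3 x y c"
    if "clique (set x)" "clique (set y)" "set x \<subseteq> S" "set y \<subseteq> S" "set c \<subseteq> S" for x y c
    using that
  proof (induction c arbitrary: x y)
    case Nil
    then show ?case using base by (simp add: clique_def)
  next
    case (Cons s c)
    have "ore3 x y ([s] @ c)"
    proof (rule ore3_append)
      show "ore3 x y [s]"
        using Cons.prems by (intro base) auto
      fix x' y'
      assume xs: "common_multiple {x, [s]}" "common_multiple {y, [s]}"
        and c: "is_complement x [s] x'" "is_complement y [s] y'"
      have "clique (set x')" "clique (set y')"
        using complement_clique xs c Cons.prems by blast+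
      moreover have "set x' \<subseteq> S" "set y' \<subseteq> S"
        using c Cons.prems unfolding is_complement_def by auto
      ultimately show "ore3 x' y' c"
        using Cons by simp
    qed
    then show ?case by simp
  qed
  have two: "ore3 x b c" if "clique (set x)" "set x \<subseteq> S" "set b \<subseteq> S" "set c \<subseteq> S" for x b c
    using that
  proof (induction c arbitrary: x b)
    case Nil
    then show ?case by (auto simp: ore3_def common_multiple_def)
  next
    case (Cons s c)
    have "ore3 x b ([s] @ c)"
    proof (rule ore3_append)
      \<comment> \<open>A single letter is itself a word with clique support, so after a rotation
        \<open>one\<close> applies with \<open>b\<close> as its arbitrary argument.\<close>
      show "ore3 x b [s]"
        using Cons.prems ore3_rotate[OF one[of "[s]" x b]] by simp
      fix x' b'
      assume xs: "common_multiple {x, [s]}" and c: "is_complement x [s] x'" "is_complement b [s] b'"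
      have "clique (set x')"
        using complement_clique xs c Cons.prems by blast
      moreover have "set x' \<subseteq> S" "set b' \<subseteq> S"
        using c Cons.prems unfolding is_complement_def by auto
      ultimately show "ore3 x' b' c"
        using Cons by simp
    qed
    then show ?case by simp
  qed
  show ?thesis
    using assms(3-5)
  proof (induction c arbitrary: a b)
    case Nil
    then show ?case by (auto simp: ore3_def common_multiple_def)
  next
    case (Cons s c)
    have "ore3 a b ([s] @ c)"
    proof (rule ore3_append)
      show "ore3 a b [s]"
        using Cons.prems ore3_rotate[OF two[of "[s]" a b]] by simp
      fix a' b'
      assume "is_complement a [s] a'" "is_complement b [s] b'"
      then show "ore3 a' b' c"
        using Cons unfolding is_complement_def by (intro Cons.IH) auto
    qed
    then show ?case by simp
  qed
qed

text \<open>Replace two elements by their lcm: by the 3-Ore condition it still has a common multiple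
  with each remaining element. The auxiliary claim singles out an element \<open>a\<close> to be
  replaced in this way.\<close>

lemma common_multiple_of_ore3:
  assumes ore: "\<And>a b c. set a \<subseteq> S \<Longrightarrow> set b \<subseteq> S \<Longrightarrow> set c \<subseteq> S \<Longrightarrow> ore3 a b c"
    and "finite A" "\<forall>x\<in>A. set x \<subseteq> S" "\<forall>x\<in>A. \<forall>y\<in>A. common_multiple {x, y}"
  shows "common_multiple A"
proof -
  have *: "common_multiple (insert a A)"
    if "finite A" "\<forall>x\<in>insert a A. set x \<subseteq> S"
      "\<forall>x\<in>insert a A. \<forall>y\<in>insert a A. common_multiple {x, y}" for a A
    using that
  proof (induction arbitrary: a rule: finite_induct)
    case empty
    then show ?case by simp
  next
    case (insert b A)
    have "common_multiple {a, b}" using insert.prems by blast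
    then obtain l where l: "is_lcm {a, b} l" "set l \<subseteq> S"
      using ex_lcm[of "{a, b}"] insert.prems(1) by fastforce
    have lc: "common_multiple {l, c}" if "c \<in> A" for c
    proof -
      have "common_multiple {a, b, c}"
        using ore[of a b c] insert.prems that unfolding ore3_def by auto
      then show ?thesis
        using l(1) unfolding is_lcm_def common_multiple_def by blast
    qed
    have "common_multiple (insert l A)"
    proof (rule insert.IH)
      show "\<forall>x\<in>insert l A. set x \<subseteq> S" using l(2) insert.prems(1) by blast
      have "common_multiple {l, l}" unfolding common_multiple_def by blast
      then show "\<forall>x\<in>insert l A. \<forall>y\<in>insert l A. common_multiple {x, y}"
        using lc insert.prems(2) by (auto simp: insert_commute)
    qed
    then show ?case
      using l(1) lprefix_trans unfolding is_lcm_def common_multiple_def by (metis insert_iff)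
  qed
  show ?thesis
  proof (cases "A = {}")
    case True
    then show ?thesis by (simp add: common_multiple_def)
  next
    case False
    then obtain a where "insert a A = A" by blast
    then show ?thesis using *[of A a] assms(2-4) by simp
  qed
qed

end

section \<open>Artin-Tits presentations\<close>

definition has_braid :: "('a list \<times> 'a list) set \<Rightarrow> 'a \<Rightarrow> 'a \<Rightarrow> nat \<Rightarrow> bool" where
  "has_braid R s t n \<longleftrightarrow> s \<noteq> t \<and> 2 \<le> n \<and>
     ((alt_word s t n, alt_word t s n) \<in> R \<or> (alt_word t s n, alt_word s t n) \<in> R)"

text \<open>For an Artin-Tits presentation the choice is unambiguous by
  \<open>cox_matrix_eq\<close>.\<close>

definition cox_matrix :: "('a list \<times> 'a list) set \<Rightarrow> 'a \<Rightarrow> 'a \<Rightarrow> nat" where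
  "cox_matrix R s t = (if \<exists>n. has_braid R s t n then SOME n. has_braid R s t n else 0)"

text \<open>Dropping the relations that leave \<open>I\<close> yields the word theory of the
  parabolic submonoid and its Coxeter group over the same type of letters.\<close>

definition restrict_matrix :: "'a set \<Rightarrow> ('a \<Rightarrow> 'a \<Rightarrow> nat) \<Rightarrow> 'a \<Rightarrow> 'a \<Rightarrow> nat" where
  "restrict_matrix I m s t = (if s \<in> I \<and> t \<in> I then m s t else 0)"

abbreviation square_relations :: "'a set \<Rightarrow> ('a list \<times> 'a list) set" where
  "square_relations I \<equiv> {([s, s], []) | s. s \<in> I}"

lemma has_braid_cox_matrix: "cox_matrix R s t \<noteq> 0 \<Longrightarrow> has_braid R s t (cox_matrix R s t)"
  unfolding cox_matrix_def by (auto intro: someI split: if_splits)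

lemma braid_matrix_cox_matrix: "braid_matrix (cox_matrix R)"
proof
  fix s t
  \<comment> \<open>Equality of the predicates makes the choice operator pick the same number in
    both orders.\<close>
  have "has_braid R s t = has_braid R t s"
    unfolding has_braid_def by auto
  then have "(if \<exists>n. has_braid R s t n then SOME n. has_braid R s t n else 0)
      = (if \<exists>n. has_braid R t s n then SOME n. has_braid R t s n else 0)"
    by (rule arg_cong)
  then show "cox_matrix R s t = cox_matrix R t s"
    unfolding cox_matrix_def .
  show "cox_matrix R s t \<noteq> 0 \<Longrightarrow> s \<noteq> t \<and> 2 \<le> cox_matrix R s t"
    using has_braid_cox_matrix[of R s t] unfolding has_braid_def by blast
qed

lemma braid_matrix_restrict:
  assumes "braid_matrix m"
  shows "braid_matrix (restrict_matrix I m)"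
proof -
  interpret braid_matrix m by (rule assms)
  show ?thesis
    by unfold_locales (use m_sym m_ge2 in \<open>auto simp: restrict_matrix_def split: if_splits\<close>)
qed

lemma has_braid_letters:
  assumes "artin_tits_presentation S R" "has_braid R s t n"
  shows "s \<in> S" "t \<in> S"
proof -
  obtain r where r: "r \<in> R" "r = (alt_word s t n, alt_word t s n) \<or> r = (alt_word t s n, alt_word s t n)"
    and n: "2 \<le> n"
    using assms(2) unfolding has_braid_def by blast
  obtain s' t' n' where "s' \<in> S" "t' \<in> S" and r': "r = (alt_word s' t' n', alt_word t' s' n')"
    using assms(1) r(1) unfolding artin_tits_presentation_def braid_relation_def by blast
  moreover have "{s, t} = {s', t'}"
  proof -
    consider "alt_word s t n = alt_word s' t' n'" | "alt_word t s n = alt_word s' t' n'"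
      using r(2) r' by auto
    then show ?thesis by cases (use alt_word_inj[OF _ n] in fastforce)+
  qed
  ultimately show "s \<in> S" "t \<in> S" by (auto simp: doubleton_eq_iff)
qed

lemma cox_matrix_eq:
  assumes "artin_tits_presentation S R" "has_braid R s t n"
  shows "cox_matrix R s t = n"
proof -
  have unique: "n' = n" if "has_braid R s t n'" for n'
  proof -
    \<comment> \<open>The length of one side recovers the exponent, so uniqueness of the relation
      implies uniqueness of the exponent.\<close>
    have ex: "\<exists>r. r \<in> R \<and> (braid_relation s t r \<or> braid_relation t s r) \<and> length (fst r) = k"
      if "has_braid R s t k" for k
      using that unfolding has_braid_def braid_relation_def by fastforce
    have "s \<noteq> t"
      using assms(2) by (simp add: has_braid_def)
    then have "\<exists>\<^sub>\<le>\<^sub>1 r. r \<in> R \<and> (braid_relation s t r \<or> braid_relation t s r)"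
      using assms(1) has_braid_letters[OF assms] unfolding artin_tits_presentation_def by simp
    then show ?thesis
      using ex[OF that] ex[OF assms(2)] by (metis (mono_tags, lifting) Uniq_D)
  qed
  have "(SOME n. has_braid R s t n) = n"
    using assms(2) unique by (rule some_equality)
  then show ?thesis
    using assms(2) unfolding cox_matrix_def by auto
qed

lemma artin_tits_relation:
  assumes "artin_tits_presentation S R" "(u, v) \<in> R"
  shows "\<exists>s t. cox_matrix R s t \<noteq> 0 \<and> u = alt_word s t (cox_matrix R s t)
    \<and> v = alt_word t s (cox_matrix R s t)"
proof -
  obtain s t n where st: "s \<noteq> t" "2 \<le> n" "u = alt_word s t n" "v = alt_word t s n"
    using assms unfolding artin_tits_presentation_def braid_relation_def by blast
  then have "has_braid R s t n"
    using assms(2) unfolding has_braid_def by blast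
  then have "cox_matrix R s t = n"
    by (rule cox_matrix_eq[OF assms(1)])
  then show ?thesis
    using st by (intro exI[of _ s] exI[of _ t]) simp
qed

lemma alt_word_in_lists: "s \<in> I \<Longrightarrow> t \<in> I \<Longrightarrow> alt_word s t n \<in> lists I"
  using set_alt_word_subset[of s t n] by (auto simp: in_lists_conv_set)

text \<open>Used both for the monoid, with \<open>R' = R\<close>, and for the Coxeter relations of a
  parabolic.\<close>

lemma pres_cong_cox_matrix:
  assumes "cox_matrix R s t \<noteq> 0" "s \<in> I" "t \<in> I" "parabolic_relations R I \<subseteq> R'"
    and "x \<in> lists I" "y \<in> lists I"
  shows "(x @ alt_word s t (cox_matrix R s t) @ y, x @ alt_word t s (cox_matrix R s t) @ y)
    \<in> pres_cong I R'"
proof -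
  let ?u = "alt_word s t (cox_matrix R s t)" and ?v = "alt_word t s (cox_matrix R s t)"
  have l: "?u \<in> lists I" "?v \<in> lists I"
    using assms(2,3) by (simp_all add: alt_word_in_lists)
  then have "(?u, ?v) \<in> R' \<or> (?v, ?u) \<in> R'"
    using has_braid_cox_matrix[OF assms(1)] assms(4)
    unfolding has_braid_def parabolic_relations_def by auto
  then show ?thesis
    using l assms(5,6) pres_cong.rel pres_cong.sym by metis
qed

section \<open>Divisibility and the 3-Ore condition of the presented monoid in terms of
  words\<close>

locale artin_tits =
  fixes S :: "'a set" and R :: "('a list \<times> 'a list) set"
  assumes presentation: "artin_tits_presentation S R"
begin

sublocale braid_matrix "cox_matrix R"
  by (rule braid_matrix_cox_matrix)

notation beq (infix "\<approx>" 50) and lprefix (infix "\<preceq>" 50)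

lemma pres_cong_iff: "(u, v) \<in> pres_cong S R \<longleftrightarrow> u \<in> lists S \<and> v \<in> lists S \<and> u \<approx> v"
proof
  have "u \<approx> v" if "(u, v) \<in> pres_cong S R"
    using that
  proof (induction rule: pres_cong.induct)
    case (rel u v x y)
    obtain s t where "cox_matrix R s t \<noteq> 0" "u = alt_word s t (cox_matrix R s t)"
        "v = alt_word t s (cox_matrix R s t)"
      using artin_tits_relation[OF presentation rel.hyps(1)] by blast
    then show ?case
      using beq_braid beq_context by blast
  qed (auto intro: beq_sym beq_trans)
  then show "(u, v) \<in> pres_cong S R \<Longrightarrow> u \<in> lists S \<and> v \<in> lists S \<and> u \<approx> v"
    using pres_cong_lists by blast
next
  assume *: "u \<in> lists S \<and> v \<in> lists S \<and> u \<approx> v"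
  then have "bstep\<^sup>*\<^sup>* u v" by (simp add: beq_def)
  then show "(u, v) \<in> pres_cong S R"
  proof (induction rule: rtranclp_induct)
    case base
    then show ?case using * by (simp add: pres_cong.refl)
  next
    case (step v w)
    have "v \<in> lists S"
      using step.IH pres_cong_lists by blast
    have "(v, w) \<in> pres_cong S R"
      using step.hyps(2)
    proof cases
      case (1 s t x y)
      then have "s \<in> S" "t \<in> S"
        using has_braid_letters[OF presentation has_braid_cox_matrix] by blast+
      then show ?thesis
        using 1 \<open>v \<in> lists S\<close> pres_cong_cox_matrix[of R s t S R x y]
        by (auto simp: parabolic_relations_def)
    qed
    then show ?case using step.IH pres_cong.trans by metis
  qed
qed

lemma right_multiple_iff:
  assumes "w \<in> lists S" "a \<in> lists S"
  shows "right_multiple (presented_monoid S R) (pres_class S R w) (pres_class S R a) \<longleftrightarrow> a \<preceq> w"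
proof -
  have "right_multiple (presented_monoid S R) (pres_class S R w) (pres_class S R a)
      \<longleftrightarrow> (\<exists>x\<in>lists S. (w, a @ x) \<in> pres_cong S R)"
    using assms by (simp add: right_multiple_def carrier_presented_monoid mult_presented_monoid
        pres_class_eq_iff)
  also have "\<dots> \<longleftrightarrow> a \<preceq> w"
  proof
    assume "\<exists>x\<in>lists S. (w, a @ x) \<in> pres_cong S R"
    then show "a \<preceq> w"
      unfolding pres_cong_iff lprefix_def using beq_sym by blast
  next
    assume "a \<preceq> w"
    then obtain x where x: "a @ x \<approx> w" unfolding lprefix_def by blast
    then have "x \<in> lists S"
      using beq_set[OF x] assms(1) by auto
    then show "\<exists>x\<in>lists S. (w, a @ x) \<in> pres_cong S R"
      using x assms beq_sym by (auto simp: pres_cong_iff)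
  qed
  finally show ?thesis .
qed

lemma left_multiple_iff:
  assumes "w \<in> lists S" "a \<in> lists S"
  shows "left_multiple (presented_monoid S R) (pres_class S R w) (pres_class S R a) \<longleftrightarrow> rev a \<preceq> rev w"
proof -
  have "left_multiple (presented_monoid S R) (pres_class S R w) (pres_class S R a)
      \<longleftrightarrow> (\<exists>x\<in>lists S. (w, x @ a) \<in> pres_cong S R)"
    using assms by (simp add: left_multiple_def carrier_presented_monoid mult_presented_monoid
        pres_class_eq_iff)
  also have "\<dots> \<longleftrightarrow> (\<exists>x. x @ a \<approx> w)"
  proof
    assume "\<exists>x\<in>lists S. (w, x @ a) \<in> pres_cong S R"
    then show "\<exists>x. x @ a \<approx> w"
      unfolding pres_cong_iff using beq_sym by blast
  next
    assume "\<exists>x. x @ a \<approx> w"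
    then obtain x where x: "x @ a \<approx> w" by blast
    then have "x \<in> lists S"
      using beq_set[OF x] assms(1) by auto
    then show "\<exists>x\<in>lists S. (w, x @ a) \<in> pres_cong S R"
      using x assms beq_sym by (auto simp: pres_cong_iff)
  qed
  also have "\<dots> \<longleftrightarrow> rev a \<preceq> rev w"
  proof -
    have "rev a @ x \<approx> rev w \<longleftrightarrow> rev x @ a \<approx> w" for x
      using beq_rev_iff[of "rev x @ a" w] by simp
    then show ?thesis
      unfolding lprefix_def by (metis rev_rev_ident)
  qed
  finally show ?thesis .
qed

lemma common_multiple_lists_iff:
  assumes "finite A" "A \<subseteq> lists S"
  shows "common_multiple A \<longleftrightarrow> (\<exists>w\<in>lists S. \<forall>a\<in>A. a \<preceq> w)"
proof
  assume "common_multiple A"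
  then obtain l where "is_lcm A l" "set l \<subseteq> \<Union> (set ` A)"
    using ex_lcm assms(1) by blast
  then show "\<exists>w\<in>lists S. \<forall>a\<in>A. a \<preceq> w"
    using assms(2) unfolding is_lcm_def by (intro bexI[of _ l]) auto
qed (auto simp: common_multiple_def)

lemma have_common_right_multiple_iff:
  assumes "finite A" "A \<subseteq> lists S"
  shows "have_common_right_multiple (presented_monoid S R) (pres_class S R ` A) \<longleftrightarrow> common_multiple A"
proof -
  have "have_common_right_multiple (presented_monoid S R) (pres_class S R ` A) \<longleftrightarrow>
      (\<exists>w\<in>lists S. \<forall>a\<in>A. a \<preceq> w)"
    using assms(2) right_multiple_iff unfolding have_common_right_multiple_def carrier_presented_monoid
    by (simp add: subset_iff)
  then show ?thesis using common_multiple_lists_iff[OF assms] by simp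
qed

lemma rev_lists: "rev ` lists S = lists S"
proof
  show "lists S \<subseteq> rev ` lists S"
  proof
    fix w assume "w \<in> lists S"
    then have "rev w \<in> lists S" by (simp add: in_lists_conv_set)
    then show "w \<in> rev ` lists S" by (metis imageI rev_rev_ident)
  qed
qed (auto simp: in_lists_conv_set)

lemma have_common_left_multiple_iff:
  assumes "finite A" "A \<subseteq> lists S"
  shows "have_common_left_multiple (presented_monoid S R) (pres_class S R ` A)
    \<longleftrightarrow> common_multiple (rev ` A)"
proof -
  have "have_common_left_multiple (presented_monoid S R) (pres_class S R ` A) \<longleftrightarrow>
      (\<exists>w\<in>lists S. \<forall>a\<in>A. rev a \<preceq> rev w)"
    using assms(2) left_multiple_iff unfolding have_common_left_multiple_def carrier_presented_monoid
    by (simp add: subset_iff)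
  also have "\<dots> \<longleftrightarrow> (\<exists>w\<in>rev ` lists S. \<forall>a\<in>rev ` A. a \<preceq> w)"
    by simp
  also have "\<dots> \<longleftrightarrow> (\<exists>w\<in>lists S. \<forall>a\<in>rev ` A. a \<preceq> w)"
    by (simp only: rev_lists)
  also have "\<dots> \<longleftrightarrow> common_multiple (rev ` A)"
    using assms by (intro common_multiple_lists_iff[symmetric]) auto
  finally show ?thesis .
qed

text \<open>Reversal is an anti-automorphism, so the condition on left multiples is the one on right
  multiples for reversed words.\<close>

lemma three_Ore_iff:
  "three_Ore (presented_monoid S R) \<longleftrightarrow> (\<forall>a\<in>lists S. \<forall>b\<in>lists S. \<forall>c\<in>lists S. ore3 a b c)"
proof -
  let ?c = "pres_class S R"
  have r: "have_common_right_multiple (presented_monoid S R) {?c a, ?c b} \<longleftrightarrow> common_multiple {a, b}"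
    "have_common_left_multiple (presented_monoid S R) {?c a, ?c b} \<longleftrightarrow> common_multiple {rev a, rev b}"
    if "a \<in> lists S" "b \<in> lists S" for a b
    using that have_common_right_multiple_iff[of "{a, b}"] have_common_left_multiple_iff[of "{a, b}"]
    by simp_all
  have r3: "have_common_right_multiple (presented_monoid S R) {?c a, ?c b, ?c c}
        \<longleftrightarrow> common_multiple {a, b, c}"
    "have_common_left_multiple (presented_monoid S R) {?c a, ?c b, ?c c}
        \<longleftrightarrow> common_multiple {rev a, rev b, rev c}"
    if "a \<in> lists S" "b \<in> lists S" "c \<in> lists S" for a b c
    using that have_common_right_multiple_iff[of "{a, b, c}"]
      have_common_left_multiple_iff[of "{a, b, c}"]
    by simp_all
  have "three_Ore (presented_monoid S R) \<longleftrightarrow>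
      (\<forall>a\<in>lists S. \<forall>b\<in>lists S. \<forall>c\<in>lists S. ore3 a b c) \<and>
      (\<forall>a\<in>lists S. \<forall>b\<in>lists S. \<forall>c\<in>lists S. ore3 (rev a) (rev b) (rev c))"
    unfolding three_Ore_def carrier_presented_monoid ball_simps ore3_def
    by (simp add: r r3 cong: ball_cong)
  moreover have "rev a \<in> lists S" if "a \<in> lists S" for a
    using that by (simp add: in_lists_conv_set)
  ultimately show ?thesis by blast
qed

lemma clique_iff:
  "clique I \<longleftrightarrow> (\<forall>s\<in>I. \<forall>t\<in>I. common_multiple {[s], [t]})"
proof -
  have "(s \<noteq> t \<longrightarrow> cox_matrix R s t \<noteq> 0) \<longleftrightarrow> common_multiple {[s], [t]}" for s t
  proof (cases "s = t")
    case True
    then show ?thesis unfolding common_multiple_def by blast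
  next
    case False
    have "common_multiple {[s], [t]}" if st: "cox_matrix R s t \<noteq> 0"
    proof -
      have "[t] \<preceq> s # cpl s t"
        using lprefix_beq_trans[OF singleton_lprefix_Cons beq_sym[OF cpl_braid[OF st]]] .
      then show ?thesis
        using singleton_lprefix_Cons unfolding common_multiple_def by blast
    qed
    then show ?thesis
      using False braid_lprefix(1) unfolding common_multiple_def by blast
  qed
  then show ?thesis unfolding clique_def by blast
qed

section \<open>Spherical type\<close>

context
  fixes I :: "'a set"
  assumes subI: "I \<subseteq> S"
begin

interpretation N: braid_matrix "restrict_matrix I (cox_matrix R)"
  by (rule braid_matrix_restrict) (rule braid_matrix_axioms)

lemma restrict_matrix_neq_0:
  "restrict_matrix I (cox_matrix R) s t \<noteq> 0 \<longleftrightarrow> s \<in> I \<and> t \<in> I \<and> cox_matrix R s t \<noteq> 0"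
  by (auto simp: restrict_matrix_def)

lemma restrict_matrix_eq: "s \<in> I \<Longrightarrow> t \<in> I \<Longrightarrow> restrict_matrix I (cox_matrix R) s t = cox_matrix R s t"
  by (simp add: restrict_matrix_def)

lemma restrict_bstep: "N.bstep u v \<Longrightarrow> bstep u v"
proof (induction rule: N.bstep.induct)
  case (1 s t x y)
  then show ?case
    using bstep.intros[of s t x y] restrict_matrix_neq_0[of s t] restrict_matrix_eq[of s t] by simp
qed

lemma bstep_restrict: "bstep u v \<Longrightarrow> set u \<subseteq> I \<Longrightarrow> N.bstep u v"
proof (induction rule: bstep.induct)
  case (1 s t x y)
  then have "s \<in> I" "t \<in> I"
    using m_ge2[of s t] by (auto simp: set_alt_word)
  then show ?case
    using N.bstep.intros[of s t x y] 1 restrict_matrix_eq[of s t] by simp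
qed

lemma restrict_beq: "N.beq u v \<Longrightarrow> u \<approx> v"
  unfolding N.beq_def beq_def using mono_rtranclp[of N.bstep bstep] restrict_bstep by blast

lemma beq_restrict: "u \<approx> v \<Longrightarrow> set u \<subseteq> I \<Longrightarrow> N.beq u v"
  unfolding beq_def
proof (induction rule: rtranclp_induct)
  case (step v w)
  then have "set v \<subseteq> I"
    using beq_set by (simp add: beq_def)
  then show ?case
    using step bstep_restrict[of v w] unfolding N.beq_def by (meson rtranclp.rtrancl_into_rtrancl)
qed simp

lemma common_multiple_restrict:
  assumes "finite I"
  shows "N.common_multiple (letters I) \<longleftrightarrow> common_multiple (letters I)"
proof
  have "u \<preceq> w" if "N.lprefix u w" for u w
    using that restrict_beq unfolding N.lprefix_def lprefix_def by blast
  then show "N.common_multiple (letters I) \<Longrightarrow> common_multiple (letters I)"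
    unfolding N.common_multiple_def common_multiple_def by blast
next
  assume "common_multiple (letters I)"
  then obtain D where D: "is_lcm (letters I) D" "set D \<subseteq> I"
    using ex_lcm[of "letters I"] assms by auto
  have "N.lprefix a D" if a: "a \<in> letters I" for a
  proof -
    obtain x where x: "a @ x \<approx> D"
      using D(1) a unfolding is_lcm_def lprefix_def by blast
    then show ?thesis
      using beq_restrict[OF x] beq_set[OF x] D(2) unfolding N.lprefix_def by blast
  qed
  then show "N.common_multiple (letters I)"
    unfolding N.common_multiple_def by blast
qed

abbreviation cox_rels :: "('a list \<times> 'a list) set" where
  "cox_rels \<equiv> parabolic_relations R I \<union> square_relations I"

lemma pres_cong_ceq: "(u, v) \<in> pres_cong I cox_rels \<Longrightarrow> N.ceq u v"
proof (induction rule: pres_cong.induct)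
  case (rel u v x y)
  have "N.ceq u v"
  proof (cases "(u, v) \<in> parabolic_relations R I")
    case True
    then obtain s t where st: "cox_matrix R s t \<noteq> 0" "u = alt_word s t (cox_matrix R s t)"
        "v = alt_word t s (cox_matrix R s t)"
      using artin_tits_relation[OF presentation] unfolding parabolic_relations_def by blast
    then have "u \<approx> v" using beq_braid by blast
    then show ?thesis
      using beq_restrict[of u v] N.beq_imp_ceq rel.hyps(2) by (auto simp: in_lists_conv_set)
  next
    case False
    then obtain s where "u = [s, s]" "v = []" using rel.hyps(1) by auto
    then show ?thesis using N.ceq_square[of "[]" s "[]"] by simp
  qed
  then show ?case by (rule N.ceq_context)
qed (auto intro: N.ceq_sym N.ceq_trans)

text \<open>A \<open>cstep\<close> may insert squares of letters outside \<open>I\<close>. Deleting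
  all such letters turns it into a Coxeter relation over \<open>I\<close> or an identity.\<close>

lemma cstep_pres_cong:
  assumes "N.cstep u v"
  shows "(filter (\<lambda>s. s \<in> I) u, filter (\<lambda>s. s \<in> I) v) \<in> pres_cong I cox_rels"
proof -
  let ?f = "filter (\<lambda>s. s \<in> I)"
  have f: "?f w \<in> lists I" for w by auto
  have sq: "(?f (x @ s # s # y), ?f (x @ y)) \<in> pres_cong I cox_rels" for x s y
  proof (cases "s \<in> I")
    case True
    then have "(?f x @ [s, s] @ ?f y, ?f x @ [] @ ?f y) \<in> pres_cong I cox_rels"
      using f by (intro pres_cong.rel) auto
    then show ?thesis using True by simp
  next
    case False
    then have "?f (x @ s # s # y) = ?f (x @ y)" by simp
    then show ?thesis using pres_cong.refl[OF f[of "x @ y"]] by simp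
  qed
  show ?thesis
    using assms
  proof cases
    case braid
    then show ?thesis
    proof (cases rule: N.bstep.cases)
      case (1 s t x y)
      then have st: "s \<in> I" "t \<in> I" "cox_matrix R s t \<noteq> 0"
        using restrict_matrix_neq_0 by blast+
      have "?f (alt_word p q k) = alt_word p q k" if "{p, q} \<subseteq> I" for p q k
        using set_alt_word_subset[of p q k] that by (auto simp: filter_id_conv)
      then show ?thesis
        using 1 st pres_cong_cox_matrix[of R s t I cox_rels "?f x" "?f y"]
        by (simp add: restrict_matrix_eq f)
    qed
  next
    case (del x s y)
    then show ?thesis using sq by simp
  next
    case (ins x y s)
    then show ?thesis using pres_cong.sym[OF sq[of x s y]] by simp
  qed
qed

lemma ceq_pres_cong:
  assumes "N.ceq u v"
  shows "(filter (\<lambda>s. s \<in> I) u, filter (\<lambda>s. s \<in> I) v) \<in> pres_cong I cox_rels"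
  using assms unfolding N.ceq_def
proof (induction rule: rtranclp_induct)
  case base
  show ?case by (rule pres_cong.refl) auto
next
  case (step v w)
  show ?case by (rule pres_cong.trans[OF step.IH cstep_pres_cong[OF step.hyps(2)]])
qed

text \<open>Deleting the letters outside \<open>I\<close> from a reduced word keeps the element,
  since \<open>u\<close> contains none, and does not lengthen the word.\<close>

lemma ex_red_lists:
  assumes "u \<in> lists I"
  shows "\<exists>v\<in>lists I. N.red v \<and> (u, v) \<in> pres_cong I cox_rels"
proof -
  let ?f = "filter (\<lambda>s. s \<in> I)"
  obtain v where v: "N.ceq u v" "N.red v" using N.ex_red by blast
  have u: "?f u = u" using assms by (auto simp: filter_id_conv)
  have c: "(u, ?f v) \<in> pres_cong I cox_rels"
    using ceq_pres_cong[OF v(1)] u by simp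
  then have "N.wlen (?f v) = length v"
    using N.wlen_cong[OF pres_cong_ceq[OF c]] N.wlen_cong[OF v(1)] v(2) unfolding N.red_def by simp
  then have "N.red (?f v)"
    using N.wlen_le_length[of "?f v"] length_filter_le[of "\<lambda>s. s \<in> I" v] unfolding N.red_def by simp
  then show ?thesis using c by (intro bexI[of _ "?f v"]) auto
qed

text \<open>If the group is finite, take a reduced word of maximal length: each letter of
  \<open>I\<close> shortens it from the left, hence divides it by Matsumoto's theorem. Conversely
  every class contains a reduced word over \<open>I\<close> that is no longer than the lcm
  \<open>D\<close>.\<close>

theorem spherical_type_iff:
  assumes "finite I"
  shows "spherical_type I (parabolic_relations R I) \<longleftrightarrow> common_multiple (letters I)"
proof -
  let ?c = "pres_class I cox_rels"
  have carrier: "carrier (coxeter_group I (parabolic_relations R I)) = ?c ` lists I"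
    unfolding coxeter_group_def by (rule carrier_presented_monoid)
  have "finite (?c ` lists I) \<longleftrightarrow> N.common_multiple (letters I)"
  proof
    assume fin: "finite (?c ` lists I)"
    have wlen: "N.wlen u = N.wlen v" if "u \<in> lists I" "v \<in> lists I" "?c u = ?c v" for u v
      using that N.wlen_cong[OF pres_cong_ceq[of u v]] pres_class_eq_iff[OF that(1,2)] by simp
    \<comment> \<open>The length depends only on the class, so finitely many classes have finitely
      many lengths and a maximum exists.\<close>
    define g where "g C = N.wlen (SOME u. u \<in> lists I \<and> ?c u = C)" for C
    have "g (?c u) = N.wlen u" if "u \<in> lists I" for u
    proof -
      have "(SOME v. v \<in> lists I \<and> ?c v = ?c u) \<in> lists I
          \<and> ?c (SOME v. v \<in> lists I \<and> ?c v = ?c u) = ?c u"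
        by (rule someI[of _ u]) (simp add: that)
      then show ?thesis
        using wlen that unfolding g_def by blast
    qed
    then have "N.wlen ` lists I = g ` ?c ` lists I"
      unfolding image_image by (intro image_cong) simp_all
    then have finw: "finite (N.wlen ` lists I)"
      using fin by simp
    have "[] \<in> lists I" by simp
    then have "Max (N.wlen ` lists I) \<in> N.wlen ` lists I"
      using finw by (intro Max_in) auto
    then obtain w0 where w0: "w0 \<in> lists I" "N.wlen w0 = Max (N.wlen ` lists I)"
      by (elim imageE) simp
    obtain w where w: "w \<in> lists I" "N.red w" "N.ceq w0 w"
      using ex_red_lists[OF w0(1)] pres_cong_ceq by blast
    have max: "N.wlen u \<le> N.wlen w" if "u \<in> lists I" for u
      using Max_ge[OF finw imageI[OF that]] N.wlen_cong[OF w(3)] w0(2) by simp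
    have "N.lprefix [s] w" if "s \<in> I" for s
    proof -
      \<comment> \<open>Descents are defined on the right, so left multiplication by
        \<open>s\<close> is studied on the reversed word.\<close>
      have "N.wlen (rev w @ [s]) = N.wlen (s # w)"
        using N.wlen_rev[of "s # w"] by simp
      also have "\<dots> \<le> N.wlen (rev w)"
        using max[of "s # w"] that w(1) N.wlen_rev by simp
      finally have "\<not> N.ascent (rev w) s" by simp
      then obtain v where v: "N.ceq (rev w) (v @ [s])" "N.red v" "N.wlen (rev w) = Suc (N.wlen v)"
        by (rule N.descentE)
      have c: "N.ceq w (s # rev v)"
        using N.ceq_rev[OF v(1)] by simp
      moreover have "N.red (s # rev v)"
        using v(2,3) w(2) N.red_ceq_length[OF w(2) c] unfolding N.red_def N.wlen_rev by simp
      ultimately have "N.beq w (s # rev v)"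
        using w(2) N.matsumoto by blast
      then show ?thesis
        using N.lprefix_beq_trans[OF N.singleton_lprefix_Cons N.beq_sym] by blast
    qed
    then show "N.common_multiple (letters I)"
      unfolding N.common_multiple_def by blast
  next
    assume "N.common_multiple (letters I)"
    then obtain D where D: "N.is_lcm (letters I) D" "set D \<subseteq> I"
      using N.ex_lcm[of "letters I"] assms by auto
    have "?c u \<in> ?c ` {v. set v \<subseteq> I \<and> length v \<le> length D}" if u: "u \<in> lists I" for u
    proof -
      obtain v where v: "v \<in> lists I" "N.red v" "(u, v) \<in> pres_cong I cox_rels"
        using ex_red_lists[OF u] by blast
      have "set v \<subseteq> I" using v(1) by auto
      moreover have "length v \<le> length D"
        using N.red_length_le_Delta[OF assms D v(2)] \<open>set v \<subseteq> I\<close> by blast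
      moreover have "?c u = ?c v"
        using pres_class_eq_iff[OF u v(1)] v(3) by blast
      ultimately show ?thesis by simp
    qed
    then have "?c ` lists I \<subseteq> ?c ` {v. set v \<subseteq> I \<and> length v \<le> length D}"
      by (rule image_subsetI)
    then show "finite (?c ` lists I)"
      by (rule finite_subset) (intro finite_imageI finite_lists_length_le assms)
  qed
  then show ?thesis
    using common_multiple_restrict[OF assms] unfolding spherical_type_def carrier by simp
qed

end

theorem three_Ore_iff_type_FC: "three_Ore (presented_monoid S R) \<longleftrightarrow> type_FC S R"
proof -
  have finS: "finite S"
    using presentation unfolding artin_tits_presentation_def by blast
  have pair: "have_common_right_multiple (presented_monoid S R) {pres_class S R [s], pres_class S R [t]}
      \<longleftrightarrow> common_multiple {[s], [t]}" if "s \<in> S" "t \<in> S" for s t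
    using that have_common_right_multiple_iff[of "{[s], [t]}"] by simp
  have "(\<forall>s\<in>I. \<forall>t\<in>I. have_common_right_multiple (presented_monoid S R)
          {pres_class S R [s], pres_class S R [t]}) \<longleftrightarrow> clique I" if "I \<subseteq> S" for I
    unfolding clique_iff using pair that by (intro ball_cong refl) auto
  moreover have "spherical_type I (parabolic_relations R I) \<longleftrightarrow> common_multiple (letters I)"
    if "I \<subseteq> S" for I
    using that finite_subset[OF that finS] by (rule spherical_type_iff)
  ultimately have FC: "type_FC S R \<longleftrightarrow> (\<forall>I\<subseteq>S. clique I \<longrightarrow> common_multiple (letters I))"
    unfolding type_FC_def by simp
  show ?thesis
    unfolding FC three_Ore_iff
  proof
    assume ore: "\<forall>a\<in>lists S. \<forall>b\<in>lists S. \<forall>c\<in>lists S. ore3 a b c"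
    show "\<forall>I\<subseteq>S. clique I \<longrightarrow> common_multiple (letters I)"
    proof (intro allI impI)
      fix I assume I: "I \<subseteq> S" "clique I"
      show "common_multiple (letters I)"
      proof (rule common_multiple_of_ore3[of S])
        show "ore3 a b c" if "set a \<subseteq> S" "set b \<subseteq> S" "set c \<subseteq> S" for a b c
          using ore that by (simp add: in_lists_conv_set subset_iff)
      qed (use I finite_subset[OF I(1) finS] clique_iff[of I] in auto)
    qed
  next
    assume "\<forall>I\<subseteq>S. clique I \<longrightarrow> common_multiple (letters I)"
    then show "\<forall>a\<in>lists S. \<forall>b\<in>lists S. \<forall>c\<in>lists S. ore3 a b c"
      by (intro ballI ore3_of_cliques[OF finS]) auto
  qed
qed

end

theorem theoremB:
  fixes S :: "'a set" and R :: "('a list \<times> 'a list) set"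
  assumes "artin_tits_presentation S R"
  shows "three_Ore (presented_monoid S R) \<longleftrightarrow> type_FC S R"
  using artin_tits.three_Ore_iff_type_FC[OF artin_tits.intro[OF assms]] .

end
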